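(* Let $\mu$ be a cardinal with $\mu>\mathrm{cf}(\mu)=\kappa>\aleph_0$ and let $\lambda=\mu^+$. Assume that for some ordinal $\theta\in(\kappa,\lambda)$, $\theta$ has the weak reflection property for $\kappa$. Then the filter ${\cal D}_\lambda\restriction S^\lambda_\kappa$ is not $\lambda^+$-saturated; that is, there are $\lambda^+$ many stationary subsets of $S^\lambda_\kappa$ such that the intersection of any two distinct of them is non-stationary in $\lambda$.
   Context: For an ordinal $\gamma$ and regular cardinal $\chi$, $S^\gamma_\chi=\{\delta<\gamma:\mathrm{cf}(\delta)=\chi\}$. ${\cal D}_\lambda$ is the club filter on $\lambda$, and ${\cal D}_\lambda\restriction S=\{X\cap S: X\in{\cal D}_\lambda\}$. A filter ${\cal D}$ on a set $A$ is $\sigma$-saturated iff there are no $\sigma$ many ${\cal D}$-positive sets (sets whose complement is not in ${\cal D}$) such that no two of them have ${\cal D}$-positive intersection. For a regular cardinal $\chi>\aleph_0$ and an ordinal $\eta>\chi$: $\eta$ has the strong non-reflection property for $\chi$ if there is a function $h:\eta\to\chi$ such that for every $\delta\in S^\eta_\chi$ there is a club $C$ of $\delta$ with $h\restriction C$ strictly increasing; otherwise $\eta$ has the weak reflection property for $\chi$ (is weakly reflective for $\chi$). *)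

theory Defs
  imports Main "HOL-Library.Countable_Set"
begin

text \<open>Ordinals are modelled as elements of an arbitrary well-ordered type 'a;
  the ordinal x is identified with the set of its predecessors {..<x}.\<close>

definition cle :: "'b set \<Rightarrow> 'c set \<Rightarrow> bool" where
  "cle A B \<longleftrightarrow> (\<exists>f. inj_on f A \<and> f ` A \<subseteq> B)"

definition clt :: "'b set \<Rightarrow> 'c set \<Rightarrow> bool" where
  "clt A B \<longleftrightarrow> cle A B \<and> \<not> cle B A"

definition equipotent :: "'b set \<Rightarrow> 'c set \<Rightarrow> bool" where
  "equipotent A B \<longleftrightarrow> (\<exists>f. bij_betw f A B)"

definition unbounded_in :: "'a::wellorder set \<Rightarrow> 'a \<Rightarrow> bool" where
  "unbounded_in X d \<longleftrightarrow> (\<forall>a<d. \<exists>c\<in>X. a \<le> c \<and> c < d)"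

definition is_limit :: "'a::wellorder \<Rightarrow> bool" where
  "is_limit g \<longleftrightarrow> (\<exists>a. a < g) \<and> (\<forall>a<g. \<exists>b. a < b \<and> b < g)"

definition club_in :: "'a::wellorder set \<Rightarrow> 'a \<Rightarrow> bool" where
  "club_in C d \<longleftrightarrow> C \<subseteq> {..<d} \<and> unbounded_in C d \<and>
     (\<forall>g<d. is_limit g \<and> (\<forall>a<g. \<exists>c\<in>C. a < c \<and> c < g) \<longrightarrow> g \<in> C)"

definition cof :: "'a::wellorder \<Rightarrow> 'a" where
  "cof d = (LEAST c. \<exists>X \<subseteq> {..<d}. unbounded_in X d \<and> equipotent X {..<c})"

definition S_cof :: "'a::wellorder \<Rightarrow> 'a \<Rightarrow> 'a set" where
  "S_cof g chi = {d. d < g \<and> cof d = chi}"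

definition stationary :: "'a::wellorder set \<Rightarrow> 'a \<Rightarrow> bool" where
  "stationary S l \<longleftrightarrow> S \<subseteq> {..<l} \<and> (\<forall>C. club_in C l \<longrightarrow> S \<inter> C \<noteq> {})"

definition is_cardinal :: "'a::wellorder \<Rightarrow> bool" where
  "is_cardinal m \<longleftrightarrow> (\<forall>b<m. \<not> equipotent {..<b} {..<m})"

definition is_csucc :: "'a::wellorder \<Rightarrow> 'a \<Rightarrow> bool" where
  "is_csucc l m \<longleftrightarrow> clt {..<m} {..<l} \<and> (\<forall>x<l. \<not> clt {..<m} {..<x})"

definition strong_nonreflection :: "'a::wellorder \<Rightarrow> 'a \<Rightarrow> bool" where
  "strong_nonreflection eta chi \<longleftrightarrow>
     (\<exists>h::'a \<Rightarrow> 'a. (\<forall>a<eta. h a < chi) \<and>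
        (\<forall>d\<in>S_cof eta chi. \<exists>C. club_in C d \<and> strict_mono_on C h))"

definition weakly_reflective :: "'a::wellorder \<Rightarrow> 'a \<Rightarrow> bool" where
  "weakly_reflective eta chi \<longleftrightarrow> \<not> strong_nonreflection eta chi"

end

theory Submission
  imports Defs
begin

text \<open>Write each $\gamma < \lambda$ as an increasing union of sets $a^\gamma_t$ ($t < \kappa$) of size
  less than $\mu$. If $\gamma$ is a limit of an unbounded set $A \subseteq \lambda$ and
  $\mathrm{cf}(\gamma) < \kappa$, some $A \cap a^\gamma_t$ is unbounded in $\gamma$; let
  $\tau_A(\gamma)$ be the least such $t$. For $\delta$ of cofinality $\kappa$ fix a club $c_\delta$
  of order type $\kappa$ and put $x^\delta_t = \bigcup_{\gamma \in c_\delta} a^\gamma_t$, which has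
  size less than $\mu$. Copying $\theta$ along a normal sequence into a given club of $\lambda$, weak
  reflection yields a $\delta$ in that club, of cofinality $\kappa$, on no club of which $\tau_A$ is
  strictly increasing; then $A \cap x^\delta_t$ is unbounded in $\delta$ for some $t$, since otherwise
  $\tau_A(c_\delta(i)) \ge i$ for club many $i < \kappa$. Hence for each $A$ some set
  $S_{A,t} = \{\delta : A \cap x^\delta_t \mbox{ is unbounded in } \delta\}$ is stationary.

  Now take more than $\lambda$ many almost disjoint sets $A$, with a common $t$. If the filter were
  saturated, there would be $\mu$ many disjoint subfamilies of size at most $\lambda$, each of which
  has its sets $S_{A,t}$ covering one and the same stationary set. The union of these subfamilies has
  size at most $\lambda$, so its members become disjoint after removing a proper initial segment from
  each. A suitable $\delta$ then lies in $\mu$ many $S_{A,t}$, and picking a point of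
  $A \cap x^\delta_t$ for each of them gives $\mu$ many distinct points of $x^\delta_t$.\<close>

subsection \<open>Cardinal comparison\<close>

lemma cle_iff_ordLeq: "cle A B \<longleftrightarrow> (card_of A, card_of B) \<in> ordLeq"
  unfolding cle_def by (rule card_of_ordLeq)

lemma cle_trans: "cle A B \<Longrightarrow> cle B C \<Longrightarrow> cle A C"
  unfolding cle_iff_ordLeq by (rule ordLeq_transitive)

lemma cle_total: "cle A B \<or> cle B A"
  unfolding cle_iff_ordLeq by (rule ordLeq_total) (rule card_of_Well_order)+

lemma cle_subset: "A \<subseteq> B \<Longrightarrow> cle A B"
  unfolding cle_iff_ordLeq by (rule card_of_mono1)

lemma cle_image: "cle (f ` A) A"
  unfolding cle_iff_ordLeq by (rule card_of_image)

lemma cleI: "inj_on f A \<Longrightarrow> f ` A \<subseteq> B \<Longrightarrow> cle A B"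
  unfolding cle_def by blast

lemma cle_UN:
  assumes "infinite B" and "cle I B" and "\<And>i. i \<in> I \<Longrightarrow> cle (A i) B"
  shows "cle (\<Union>i\<in>I. A i) B"
  using assms unfolding cle_iff_ordLeq by (intro card_of_UNION_ordLeq_infinite) auto

lemma cle_Times_same: "infinite A \<Longrightarrow> cle (A \<times> A) A"
  unfolding cle_iff_ordLeq using card_of_Times_same_infinite ordIso_iff_ordLeq by blast

lemma cle_antisym: "cle A B \<Longrightarrow> cle B A \<Longrightarrow> equipotent A B"
  unfolding cle_def equipotent_def by (meson Schroeder_Bernstein)

lemma equipotent_cle:
  assumes "equipotent A B"
  shows "cle A B" and "cle B A"
  using assms bij_betw_inv_into unfolding equipotent_def cle_def bij_betw_def
  by blast (metis assms bij_betw_def bij_betw_inv_into equipotent_def order_refl)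

lemma cle_insert:
  assumes "infinite A"
  shows "cle (insert x A) A"
proof -
  obtain h where "bij_betw h A (A \<union> {x})" using infinite_imp_bij_betw2[OF assms] by blast
  then show ?thesis using equipotent_cle(2)[of A "insert x A"] unfolding equipotent_def by auto
qed

lemma finite_cle: "finite A \<Longrightarrow> infinite B \<Longrightarrow> cle A B"
  using cle_total[of A B] unfolding cle_iff_ordLeq by (metis card_of_ordLeq_finite)

lemma countable_cle:
  assumes "countable A" "cle B A" shows "countable B"
  using assms unfolding cle_def by (meson countable_image_inj_on countable_subset)

section \<open>Increasing enumerations and order types\<close>

function enumerate_set :: "'a::wellorder set \<Rightarrow> 'a \<Rightarrow> 'a" where
  "enumerate_set Z x = (LEAST y. y \<in> Z \<and> (\<forall>z. z < x \<longrightarrow> enumerate_set Z z < y))"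
  by pat_completeness auto
termination
  by (relation "inv_image {(x, y). x < y} snd") (auto simp: wf)

declare enumerate_set.simps [simp del]

lemma ex_enumeration:
  fixes Z :: "'a::wellorder set"
  assumes "Z \<subseteq> {..<l}"
  obtains c e where "c \<le> l" "strict_mono_on {..<c} e" "e ` {..<c} = Z"
proof -
  define e where "e = enumerate_set Z"
  define Q where "Q c \<longleftrightarrow> c = l \<or> \<not> (\<exists>y\<in>Z. \<forall>z<c. e z < y)" for c
  define c where "c = (LEAST c. Q c)"
  have "Q l" by (simp add: Q_def)
  then have cl: "c \<le> l" and Qc: "Q c" unfolding c_def by (auto intro: Least_le LeastI)
  have ex: "\<exists>y. y \<in> Z \<and> (\<forall>z<x. e z < y)" if "x < c" for x
    using that not_less_Least unfolding c_def Q_def by blast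
  have ein: "e x \<in> Z" and egt: "\<And>z. z < x \<Longrightarrow> e z < e x" if "x < c" for x
    using LeastI_ex[OF ex[OF that]] enumerate_set.simps[of Z x] unfolding e_def by metis+
  have ele: "e x \<le> y" if "y \<in> Z" "\<forall>z<x. e z < y" for x y
    using that Least_le[of "\<lambda>y. y \<in> Z \<and> (\<forall>z<x. e z < y)" y] enumerate_set.simps[of Z x]
    unfolding e_def by metis
  have ge: "x < c \<Longrightarrow> x \<le> e x" for x
  proof (induction x rule: less_induct)
    case (less x)
    show ?case
    proof (rule ccontr)
      assume a: "\<not> x \<le> e x"
      then have "e x \<le> e (e x)" using less by auto
      moreover have "e (e x) < e x" using egt[of x "e x"] less a by auto
      ultimately show False by simp
    qed
  qed
  have "y \<in> e ` {..<c}" if y: "y \<in> Z" for y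
  proof (rule ccontr)
    assume n: "y \<notin> e ` {..<c}"
    have lt: "z < c \<Longrightarrow> e z < y" for z
    proof (induction z rule: less_induct)
      case (less z)
      then have "e z \<le> y" using ele[OF y, of z] by auto
      moreover have "e z \<noteq> y" using n less by auto
      ultimately show ?case by simp
    qed
    then have "c = l" using Qc y unfolding Q_def by auto
    then have "y < c" using y assms by auto
    then show False using lt[of y] ge[of y] by simp
  qed
  then have "e ` {..<c} = Z" using ein by auto
  moreover have "strict_mono_on {..<c} e" using egt by (auto intro!: strict_mono_onI)
  ultimately show thesis using that cl by blast
qed

text \<open>An injection moves \<open>Y\<close> into \<open>{..<b}\<close>, and the length of the
  increasing enumeration of its image is the required \<open>c\<close>. This links
  \<open>cle\<close> with the equipotence in the definition of \<open>cof\<close>.\<close>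

lemma ex_equipotent_initial:
  fixes b :: "'a::wellorder"
  assumes "cle Y {..<b}"
  shows "\<exists>c\<le>b. equipotent Y {..<c}"
proof -
  obtain f where f: "inj_on f Y" "f ` Y \<subseteq> {..<b}" using assms unfolding cle_def by blast
  obtain c e where c: "c \<le> b" "strict_mono_on {..<c} e" "e ` {..<c} = f ` Y"
    using ex_enumeration[OF f(2)] by blast
  have "inj_on e {..<c}" using c(2) by (rule strict_mono_on_imp_inj_on)
  then have "cle {..<c} (f ` Y)" "cle (f ` Y) {..<c}"
    using c(3) cle_image[of e "{..<c}"] by (auto intro: cleI)
  moreover have "cle Y (f ` Y)" "cle (f ` Y) Y" using f(1) cle_image by (auto intro: cleI)
  ultimately show ?thesis using c(1) by (meson cle_antisym cle_trans)
qed

subsection \<open>Cofinality and regularity\<close>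

lemma cof_witness:
  fixes d :: "'a::wellorder"
  shows "\<exists>X\<subseteq>{..<d}. unbounded_in X d \<and> equipotent X {..<cof d}"
proof -
  have "\<exists>X\<subseteq>{..<d}. unbounded_in X d \<and> equipotent X {..<d}"
    by (rule exI[of _ "{..<d}"]) (auto simp: unbounded_in_def equipotent_def bij_betw_def intro!: exI[of _ id])
  then show ?thesis unfolding cof_def by (rule LeastI)
qed

lemma cof_le:
  assumes "X \<subseteq> {..<d}" "unbounded_in X d" "cle X {..<c}"
  shows "cof d \<le> c"
proof -
  obtain c' where "c' \<le> c" "equipotent X {..<c'}" using ex_equipotent_initial[OF assms(3)] by blast
  moreover from this have "cof d \<le> c'" unfolding cof_def using assms by (intro Least_le) blast
  ultimately show ?thesis by simp
qed

text \<open>The premise \<open>\<not> cle {..<cof d} X\<close> expresses |X| < cf(d). An unbounded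
  \<open>X\<close> of this kind would be equipotent with \<open>{..<c}\<close> for some
  \<open>c \<le> cof d\<close>, while minimality of \<open>cof d\<close> forces
  \<open>c = cof d\<close>.\<close>

lemma bounded_of_small:
  assumes "X \<subseteq> {..<d}" "\<not> cle {..<cof d} X"
  shows "\<exists>b<d. \<forall>x\<in>X. x < b"
proof (rule ccontr)
  assume a: "\<not> ?thesis"
  then have u: "unbounded_in X d" using assms(1) unfolding unbounded_in_def
    by (meson lessThan_iff not_less subsetD)
  have "cle X {..<cof d}" using assms cle_total by blast
  then obtain c where c: "c \<le> cof d" "equipotent X {..<c}" using ex_equipotent_initial by blast
  then have "cof d \<le> c" using cof_le[OF assms(1) u] equipotent_cle by blast
  then show False using c assms(2) equipotent_cle by (metis order_antisym)
qed

text \<open>Regularity is phrased by the boundedness of small sets rather than by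
  \<open>cof l = l\<close>, since it is obtained by counting for \<open>lam\<close> and through
  \<open>cof\<close> for \<open>kappa\<close>.\<close>

definition regular_uncountable :: "'a::wellorder \<Rightarrow> bool" where
  "regular_uncountable l \<longleftrightarrow> uncountable {..<l} \<and> (\<forall>x<l. \<not> cle {..<l} {..<x}) \<and>
     (\<forall>X\<subseteq>{..<l}. \<not> cle {..<l} X \<longrightarrow> (\<exists>b<l. \<forall>x\<in>X. x < b))"

lemma regular_uncountableD:
  assumes "regular_uncountable l"
  shows "uncountable {..<l}" "x < l \<Longrightarrow> \<not> cle {..<l} {..<x}"
    "X \<subseteq> {..<l} \<Longrightarrow> \<not> cle {..<l} X \<Longrightarrow> \<exists>b<l. \<forall>x\<in>X. x < b"
  using assms unfolding regular_uncountable_def by blast+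

lemma cof_not_cle:
  assumes "x < cof d"
  shows "\<not> cle {..<cof d} {..<x}"
proof
  assume a: "cle {..<cof d} {..<x}"
  obtain X where X: "X\<subseteq>{..<d}" "unbounded_in X d" "equipotent X {..<cof d}" using cof_witness by blast
  then have "cof d \<le> x" using cof_le[OF X(1,2)] a equipotent_cle cle_trans by blast
  then show False using assms by simp
qed

text \<open>Let \<open>s y\<close> bound the first \<open>y\<close> terms of an enumeration
  \<open>f\<close> of a cofinal set in \<open>d\<close>. For a small \<open>Y\<close> the values
  \<open>s y\<close> with \<open>y\<close> in \<open>Y\<close> lie below some \<open>f z\<close>,
  and no such \<open>y\<close> can exceed \<open>z\<close>, as otherwise
  \<open>f z < s y\<close>.\<close>

lemma regular_uncountable_cof:
  assumes "uncountable {..<cof d}"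
  shows "regular_uncountable (cof d)"
  unfolding regular_uncountable_def
proof (intro conjI allI impI)
  show "uncountable {..<cof d}" by fact
  show "\<not> cle {..<cof d} {..<x}" if "x < cof d" for x using that by (rule cof_not_cle)
next
  fix Y assume Y: "Y \<subseteq> {..<cof d}" "\<not> cle {..<cof d} Y"
  obtain X where X: "X\<subseteq>{..<d}" "unbounded_in X d" "equipotent X {..<cof d}" using cof_witness by blast
  then obtain f where f: "bij_betw f {..<cof d} X" unfolding equipotent_def using bij_betw_inv by blast
  have "\<exists>b<d. \<forall>x\<in>f ` {..<y}. x < b" if "y < cof d" for y
  proof (rule bounded_of_small)
    show "f ` {..<y} \<subseteq> {..<d}" using f X(1) that unfolding bij_betw_def by force
    show "\<not> cle {..<cof d} (f ` {..<y})" using cof_not_cle[OF that] cle_image cle_trans by blast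
  qed
  then obtain s where s: "\<And>y. y < cof d \<Longrightarrow> s y < d \<and> (\<forall>x\<in>f ` {..<y}. x < s y)" by metis
  have "\<exists>b<d. \<forall>x\<in>s ` Y. x < b"
  proof (rule bounded_of_small)
    show "s ` Y \<subseteq> {..<d}" using s Y by auto
    show "\<not> cle {..<cof d} (s ` Y)" using Y cle_image cle_trans by blast
  qed
  then obtain b where b: "b < d" "\<And>y. y \<in> Y \<Longrightarrow> s y < b" by auto
  obtain x where x: "x \<in> X" "b \<le> x" using X(2) b(1) unfolding unbounded_in_def by blast
  then obtain z where z: "z < cof d" "f z = x" using f unfolding bij_betw_def by auto
  have "y < cof d \<and> y \<le> z" if "y \<in> Y" for y
  proof -
    have "y < cof d" using that Y by auto
    moreover have "y \<le> z"
    proof (rule ccontr)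
      assume "\<not> y \<le> z"
      then have "x < s y" using s[OF \<open>y < cof d\<close>] z by auto
      then show False using b(2)[OF that] x by simp
    qed
    ultimately show ?thesis by simp
  qed
  \<comment> \<open>A strict bound is needed, so \<open>cof d\<close> must not be the successor of
    \<open>z\<close>; an infinite initial ordinal is no successor.\<close>
  moreover have "\<exists>z'<cof d. z < z'"
  proof (rule ccontr)
    assume "\<not> ?thesis"
    then have e: "{..<cof d} = insert z {..<z}" using z(1) by force
    have "infinite {..<z}" using assms unfolding e by (auto intro: countable_finite)
    then have "cle (insert z {..<z}) {..<z}" by (rule cle_insert)
    then show False using cof_not_cle[OF z(1)] e by simp
  qed
  ultimately show "\<exists>b<cof d. \<forall>x\<in>Y. x < b" by (meson le_less_trans)
qed

lemma csucc_cle: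
  assumes "is_csucc l m" "x < l"
  shows "cle {..<x} {..<m}" "\<not> cle {..<l} {..<m}"
  using assms cle_total unfolding is_csucc_def clt_def by blast+

text \<open>A set \<open>X\<close> of size below \<open>l\<close> has at most \<open>m\<close>
  elements, and so has each closed initial segment \<open>insert x {..<x}\<close>. Their union again
  has at most \<open>m\<close> elements and misses some \<open>b < l\<close>, which then lies above
  all of \<open>X\<close>.\<close>

lemma regular_uncountable_csucc:
  assumes s: "is_csucc l m" and m: "uncountable {..<m}"
  shows "regular_uncountable l"
  unfolding regular_uncountable_def
proof (intro conjI allI impI)
  have ml: "cle {..<m} {..<l}" "\<not> cle {..<l} {..<m}" using s unfolding is_csucc_def clt_def by blast+
  show "uncountable {..<l}" using ml m countable_cle by blast
  show "\<not> cle {..<l} {..<x}" if "x < l" for x using csucc_cle[OF s that] cle_trans by blast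
  fix X assume X: "X \<subseteq> {..<l}" "\<not> cle {..<l} X"
  have "cle X {..<l}" using X cle_subset by blast
  then obtain c where c: "c \<le> l" "equipotent X {..<c}" using ex_equipotent_initial by blast
  then have "c \<noteq> l" using X(2) equipotent_cle by blast
  then have "cle {..<c} {..<m}" using csucc_cle[OF s] c by simp
  then have Xm: "cle X {..<m}" using c equipotent_cle cle_trans by blast
  have inf: "infinite {..<m}" using m by (auto intro: countable_finite)
  have "cle (insert x {..<x}) {..<m}" if "x \<in> X" for x
  proof (cases "finite {..<x}")
    case True
    then show ?thesis using inf by (simp add: finite_cle)
  next
    case False
    then have "cle (insert x {..<x}) {..<x}" by (rule cle_insert)
    then show ?thesis using csucc_cle[OF s, of x] that X cle_trans by blast
  qed
  then have "cle (\<Union>x\<in>X. insert x {..<x}) {..<m}" by (rule cle_UN[OF inf Xm])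
  then have "\<not> {..<l} \<subseteq> (\<Union>x\<in>X. insert x {..<x})" using ml cle_subset cle_trans by blast
  then obtain b where "b < l" "\<forall>x\<in>X. \<not> b \<le> x" by (force simp: le_less)
  then show "\<exists>b<l. \<forall>x\<in>X. x < b" by (auto simp: not_le)
qed

subsection \<open>Clubs and stationary sets\<close>

lemma regular_bounded_seq:
  assumes "regular_uncountable l" "\<And>n::nat. s n < l"
  shows "\<exists>b<l. \<forall>n. s n < b"
proof -
  have "\<not> cle {..<l} (range s)"
    using regular_uncountableD(1)[OF assms(1)] countable_cle[of "range s" "{..<l}"] by auto
  then obtain b where "b < l" "\<forall>x\<in>range s. x < b"
    using regular_uncountableD(3)[OF assms(1), of "range s"] assms(2) by auto
  then show ?thesis by auto
qed

lemma regular_image_bounded: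
  assumes "regular_uncountable l" "\<not> cle {..<l} I" "\<And>i. i \<in> I \<Longrightarrow> f i < l"
  shows "\<exists>b<l. \<forall>i\<in>I. f i < b"
proof -
  have "\<not> cle {..<l} (f ` I)" using assms(2) cle_image cle_trans by blast
  then obtain b where "b < l" "\<forall>x\<in>f ` I. x < b"
    using regular_uncountableD(3)[OF assms(1), of "f ` I"] assms(3) by auto
  then show ?thesis by auto
qed

lemma regular_limit:
  assumes "regular_uncountable l" "a < l"
  shows "\<exists>b<l. a < b"
  using regular_bounded_seq[OF assms(1), of "\<lambda>_. a"] assms(2) by auto

text \<open>The ordinal \<open>i\<close> is the supremum of the iterates of \<open>nx\<close> from
  \<open>a\<close>. Since \<open>nx\<close> need not be monotone, only cofinally many
  \<open>y\<close> below \<open>i\<close> are claimed to satisfy \<open>nx y < i\<close>.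
  Boundedness of sequences is a hypothesis, to cover both regular ordinals and ordinals of
  uncountable cofinality.\<close>

lemma omega_iteration:
  fixes d :: "'a::wellorder"
  assumes seq: "\<And>s :: nat \<Rightarrow> 'a. (\<And>n. s n < d) \<Longrightarrow> \<exists>b<d. \<forall>n. s n < b"
    and nx: "\<And>x. x < d \<Longrightarrow> nx x < d \<and> x < nx x" and a: "a < d"
  obtains i where "a < i" "i < d" "is_limit i" "\<And>x. x < i \<Longrightarrow> \<exists>y. x \<le> y \<and> y < i \<and> nx y < i"
proof -
  define s where "s n = (nx ^^ n) a" for n
  have sl: "s n < d" for n by (induction n) (use a nx in \<open>auto simp: s_def\<close>)
  have sS: "s (Suc n) = nx (s n)" "s n < s (Suc n)" for n using nx[OF sl[of n]] by (auto simp: s_def)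
  define i where "i = (LEAST b. \<forall>n. s n < b)"
  obtain b where b: "b < d" "\<forall>n. s n < b" using seq[of s] sl by blast
  have si: "s n < i" for n unfolding i_def using b(2) by (rule LeastI2) auto
  have "i \<le> b" unfolding i_def using b(2) by (rule Least_le)
  then have il: "i < d" using b(1) by simp
  have below: "\<exists>n. x \<le> s n" if x: "x < i" for x
  proof (rule ccontr)
    assume "\<not> ?thesis"
    then have "\<forall>n. s n < x" by (simp add: not_le)
    then have "i \<le> x" unfolding i_def by (rule Least_le)
    then show False using x by simp
  qed
  show thesis
  proof
    show "a < i" using si[of 0] by (simp add: s_def)
    show "is_limit i" unfolding is_limit_def using si below sS(2) by (meson le_less_trans)
    show "\<exists>y. x \<le> y \<and> y < i \<and> nx y < i" if "x < i" for x
      using below[OF that] si sS(1) by metis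
  qed (rule il)
qed

text \<open>Including \<open>is_limit\<close> supplies what \<open>club_in\<close> demands of a
  point before it is put into another club.\<close>

definition closure_points :: "('a::wellorder \<Rightarrow> 'a) \<Rightarrow> 'a \<Rightarrow> 'a set" where
  "closure_points F l = {i. i < l \<and> is_limit i \<and> (\<forall>x<i. F x < i)}"

lemma club_closure_points:
  assumes l: "regular_uncountable l" and F: "\<And>x. x < l \<Longrightarrow> F x < l"
  shows "club_in (closure_points F l) l"
  unfolding club_in_def
proof (intro conjI allI impI)
  show "closure_points F l \<subseteq> {..<l}" unfolding closure_points_def by auto
  show "unbounded_in (closure_points F l) l"
    unfolding unbounded_in_def
  proof (intro allI impI)
    fix a assume a: "a < l"
    \<comment> \<open>The next point must dominate \<open>F\<close> on all of \<open>{..<x}\<close>,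
      because \<open>F\<close> need not be monotone and \<open>omega_iteration\<close> controls
      \<open>nx\<close> only at cofinally many points.\<close>
    have "\<exists>b<l. x < b \<and> (\<forall>z<x. F z < b)" if "x < l" for x
    proof -
      have "\<exists>b<l. \<forall>z\<in>{..<x}. F z < b"
        using regular_image_bounded[OF l regular_uncountableD(2)[OF l that], of F] F that by auto
      then obtain b where b: "b < l" "\<forall>z<x. F z < b" by auto
      then have "max b x < l" using that by simp
      then obtain c where "c < l" "max b x < c" using regular_limit[OF l] by blast
      then show ?thesis using b by (intro exI[of _ c]) (auto intro: less_trans)
    qed
    then obtain nx where nx: "\<And>x. x < l \<Longrightarrow> nx x < l \<and> x < nx x \<and> (\<forall>z<x. F z < nx x)" by metis
    obtain i where i: "a < i" "i < l" "is_limit i"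
        "\<And>x. x < i \<Longrightarrow> \<exists>y. x \<le> y \<and> y < i \<and> nx y < i"
      using omega_iteration[of l nx a] regular_bounded_seq[OF l] nx a by metis
    have "F x < i" if x: "x < i" for x
    proof -
      obtain x' where "x < x'" "x' < i" using i(3) x unfolding is_limit_def by blast
      then obtain y where "x < y" "y < i" "nx y < i" using i(4) by (meson less_le_trans)
      then show ?thesis using nx[of y] i(2) by (meson less_trans)
    qed
    then have "i \<in> closure_points F l" using i unfolding closure_points_def by blast
    then show "\<exists>c\<in>closure_points F l. a \<le> c \<and> c < l" using i less_imp_le by blast
  qed
  fix g assume g: "g < l" and *: "is_limit g \<and> (\<forall>a<g. \<exists>c\<in>closure_points F l. a < c \<and> c < g)"
  have "F x < g" if "x < g" for x
  proof -
    obtain c where "c \<in> closure_points F l" "x < c" "c < g" using * \<open>x < g\<close> by blast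
    then show ?thesis unfolding closure_points_def by (auto intro: less_trans)
  qed
  then show "g \<in> closure_points F l" using g * unfolding closure_points_def by blast
qed

lemma club_unbounded_gt:
  assumes "regular_uncountable l" "unbounded_in C l" "x < l"
  shows "\<exists>c\<in>C. x < c \<and> c < l"
proof -
  obtain b where "b < l" "x < b" using regular_limit[OF assms(1,3)] by blast
  then show ?thesis using assms(2) unfolding unbounded_in_def by (meson less_le_trans)
qed

lemma closure_points_limit:
  assumes nx: "\<And>x. x < l \<Longrightarrow> nx x \<in> C \<and> x < nx x" and F: "\<And>x. x < l \<Longrightarrow> nx x \<le> F x"
    and i: "i \<in> closure_points F l" and x: "x < i"
  shows "\<exists>c\<in>C. x < c \<and> c < i"
proof -
  have "x < l" "F x < i" using i x unfolding closure_points_def by (auto intro: less_trans)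
  then show ?thesis using nx[of x] F[of x] by (meson le_less_trans)
qed

text \<open>One function \<open>F\<close> bounds the next element of \<open>E i\<close> for all
  \<open>i\<close> at once; its closure points are limits of every \<open>E i\<close>. The sets need
  only be unbounded, so a club can be treated together with an arbitrary unbounded set.\<close>

lemma club_Inter_small:
  assumes l: "regular_uncountable l" and I: "\<not> cle {..<l} I"
    and E: "\<And>i. i \<in> I \<Longrightarrow> unbounded_in (E i) l"
  shows "\<exists>C. club_in C l \<and> (\<forall>a\<in>C. is_limit a \<and> (\<forall>i\<in>I. \<forall>x<a. \<exists>c\<in>E i. x < c \<and> c < a))"
proof -
  have "\<forall>i\<in>I. \<forall>x. \<exists>c. x < l \<longrightarrow> c \<in> E i \<and> x < c \<and> c < l"
    using club_unbounded_gt[OF l E] by blast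
  then obtain nx where nx: "\<And>i x. i \<in> I \<Longrightarrow> x < l \<Longrightarrow> nx i x \<in> E i \<and> x < nx i x \<and> nx i x < l"
    by metis
  have "\<exists>b<l. \<forall>i\<in>I. nx i x < b" if "x < l" for x
    using regular_image_bounded[OF l I, of "\<lambda>i. nx i x"] nx that by blast
  then obtain F where F: "\<And>x. x < l \<Longrightarrow> F x < l \<and> (\<forall>i\<in>I. nx i x < F x)" by metis
  show ?thesis
  proof (intro exI[of _ "closure_points F l"] conjI ballI allI impI)
    show "club_in (closure_points F l) l" using club_closure_points[OF l] F by blast
    fix a assume a: "a \<in> closure_points F l"
    then show "is_limit a" unfolding closure_points_def by blast
    fix i x assume i: "i \<in> I" and x: "x < a"
    show "\<exists>c\<in>E i. x < c \<and> c < a"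
      using closure_points_limit[of l "nx i" "E i" F a x] nx[OF i] F i a x less_imp_le by blast
  qed
qed

lemma club_mem_limit:
  assumes "club_in C l" "a < l" "is_limit a" "\<And>x. x < a \<Longrightarrow> \<exists>c\<in>C. x < c \<and> c < a"
  shows "a \<in> C"
  using assms unfolding club_in_def by blast

lemma club_unbounded: "club_in C l \<Longrightarrow> unbounded_in C l"
  unfolding club_in_def by blast

lemma club_less: "club_in C l \<Longrightarrow> a \<in> C \<Longrightarrow> a < l"
  unfolding club_in_def by auto

lemma club_Inter:
  assumes l: "regular_uncountable l" and I: "\<not> cle {..<l} I"
    and E: "\<And>i. i \<in> I \<Longrightarrow> club_in (E i) l"
  shows "\<exists>C. club_in C l \<and> (\<forall>i\<in>I. C \<subseteq> E i)"
proof -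
  obtain C where "club_in C l" "\<forall>a\<in>C. is_limit a \<and> (\<forall>i\<in>I. \<forall>x<a. \<exists>c\<in>E i. x < c \<and> c < a)"
    using club_Inter_small[OF l I, of E] E club_unbounded by blast
  note C = this
  have "C \<subseteq> E i" if "i \<in> I" for i
  proof
    fix a assume a: "a \<in> C"
    show "a \<in> E i"
      by (rule club_mem_limit[OF E[OF that] club_less[OF C(1) a]]) (use C(2) a that in blast)+
  qed
  then show ?thesis using C(1) by blast
qed

lemma infinite_regular: "regular_uncountable l \<Longrightarrow> infinite {..<l}"
  using regular_uncountableD(1) countable_finite by blast

lemma club_Int:
  assumes l: "regular_uncountable l" and "club_in C l" "club_in D l"
  shows "\<exists>E. club_in E l \<and> E \<subseteq> C \<and> E \<subseteq> D"
proof -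
  have "\<not> cle {..<l} (UNIV :: bool set)"
    using regular_uncountableD(1)[OF l] countable_cle by (metis finite_class.finite_UNIV countable_finite)
  moreover have "club_in (if i then C else D) l" for i :: bool using assms(2,3) by simp
  ultimately have "\<exists>E. club_in E l \<and> (\<forall>i\<in>UNIV. E \<subseteq> (if i then C else D))"
    by (intro club_Inter[OF l])
  then show ?thesis by (metis UNIV_I)
qed

lemma stationaryD: "stationary S l \<Longrightarrow> club_in C l \<Longrightarrow> \<exists>a\<in>S. a \<in> C"
  unfolding stationary_def by blast

lemma stationary_UN_small:
  assumes l: "regular_uncountable l" and I: "\<not> cle {..<l} I"
    and S: "stationary (\<Union>i\<in>I. S i) l"
  shows "\<exists>i\<in>I. stationary (S i) l"
proof (rule ccontr)
  assume a: "\<not> ?thesis"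
  have "S i \<subseteq> {..<l}" if "i \<in> I" for i using S that unfolding stationary_def by blast
  then have "\<forall>i\<in>I. \<exists>C. club_in C l \<and> S i \<inter> C = {}" using a unfolding stationary_def by blast
  then obtain E where E: "\<And>i. i \<in> I \<Longrightarrow> club_in (E i) l \<and> S i \<inter> E i = {}" by metis
  then obtain C where "club_in C l" "\<forall>i\<in>I. C \<subseteq> E i" using club_Inter[OF l I, of E] by blast
  then show False using stationaryD[OF S] E by blast
qed

lemma stationary_gt:
  assumes l: "regular_uncountable l" and S: "stationary S l" and b: "b < l"
  shows "\<exists>a\<in>S. b < a"
proof -
  have "\<exists>c\<in>closure_points (\<lambda>_. b) l. c \<in> S"
    using stationaryD[OF S club_closure_points[OF l, of "\<lambda>_. b"]] b by blast
  then show ?thesis unfolding closure_points_def is_limit_def by blast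
qed

lemma stationary_Int_club:
  assumes l: "regular_uncountable l" and S: "stationary S l" and C: "club_in C l"
  shows "stationary (S \<inter> C) l"
proof -
  have "\<exists>a. a \<in> S \<inter> C \<inter> D" if "club_in D l" for D
    using club_Int[OF l C that] stationaryD[OF S] by blast
  then show ?thesis using S unfolding stationary_def by blast
qed

subsection \<open>Normal sequences\<close>

text \<open>The parameter \<open>G\<close> forces the sequence past chosen points: the next member
  of a club in one application, the terms of a cofinal set in the other. Taking least values gives
  continuity.\<close>

function normal_seq :: "('a::wellorder \<Rightarrow> 'a \<Rightarrow> 'a) \<Rightarrow> 'a \<Rightarrow> 'a" where
  "normal_seq G x = (LEAST y. \<forall>z. z < x \<longrightarrow> normal_seq G z < y \<and> G z (normal_seq G z) < y)"
  by pat_completeness auto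
termination
  by (relation "inv_image {(x, y). x < y} snd") (auto simp: wf)

declare normal_seq.simps [simp del]

lemma ex_normal_seq:
  fixes G :: "'a::wellorder \<Rightarrow> 'a \<Rightarrow> 'a"
  assumes bdd: "\<And>x f. x < c \<Longrightarrow> (\<And>z. z < x \<Longrightarrow> f z < l) \<Longrightarrow> \<exists>b<l. \<forall>z<x. f z < b"
    and G: "\<And>z y. z < c \<Longrightarrow> y < l \<Longrightarrow> G z y < l"
  obtains N where "\<And>x. x < c \<Longrightarrow> N x < l" "\<And>z x. z < x \<Longrightarrow> x < c \<Longrightarrow> N z < N x"
    "\<And>z x. z < x \<Longrightarrow> x < c \<Longrightarrow> G z (N z) < N x"
    "\<And>x y. x < c \<Longrightarrow> is_limit x \<Longrightarrow> y < N x \<Longrightarrow> \<exists>z<x. y < N z"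
proof -
  define N where "N = normal_seq G"
  define P where "P x y \<longleftrightarrow> (\<forall>z<x. N z < y \<and> G z (N z) < y)" for x y
  have Neq: "N x = (LEAST y. P x y)" for x
    unfolding N_def P_def by (rule normal_seq.simps)
  have main: "N x < l \<and> P x (N x)" if "x < c" for x
    using that
  proof (induction x rule: less_induct)
    case (less x)
    then have *: "N z < l \<and> G z (N z) < l" if "z < x" for z using that G by (meson less_trans)
    then obtain b where b: "b < l" "\<forall>z<x. max (N z) (G z (N z)) < b"
      using bdd[OF less.prems, of "\<lambda>z. max (N z) (G z (N z))"] by auto
    then have P: "P x b" unfolding P_def by auto
    then have "P x (N x)" "N x \<le> b" unfolding Neq by (auto intro: LeastI Least_le)
    then show ?case using b by simp
  qed
  show thesis
  proof
    show "N x < l" if "x < c" for x using main that by blast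
    show mono: "N z < N x" if "z < x" "x < c" for z x using main that unfolding P_def by blast
    show G: "G z (N z) < N x" if "z < x" "x < c" for z x using main that unfolding P_def by blast
    show "\<exists>z<x. y < N z" if x: "x < c" "is_limit x" "y < N x" for x y
    proof -
      \<comment> \<open>By minimality some \<open>z\<close> has \<open>y\<close> at most
        \<open>N z\<close> or \<open>G z (N z)\<close>; as \<open>x\<close> is a limit, a later
        index \<open>z'\<close> below \<open>x\<close> passes both.\<close>
      have "\<not> P x y" using x(3) not_less_Least unfolding Neq by blast
      then obtain z where z: "z < x" "y \<le> N z \<or> y \<le> G z (N z)" unfolding P_def by (auto simp: not_less)
      obtain z' where "z < z'" "z' < x" using x(2) z unfolding is_limit_def by blast
      moreover from this have "N z < N z'" "G z (N z) < N z'" using mono G x(1) by (meson less_trans)+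
      ultimately show ?thesis using z(2) by (auto intro: le_less_trans)
    qed
  qed
qed

lemma normal_is_limit:
  assumes "\<And>z x. z < x \<Longrightarrow> x < c \<Longrightarrow> N z < N x"
    "\<And>x y. x < c \<Longrightarrow> is_limit x \<Longrightarrow> y < N x \<Longrightarrow> \<exists>z<x. y < N z"
    "x < c" "is_limit x"
  shows "is_limit (N x)"
proof -
  have "\<exists>z<x. y < N z" if "y < N x" for y by (rule assms(2)[OF assms(3,4) that])
  moreover obtain z where "z < x" using assms(4) unfolding is_limit_def by blast
  moreover have "N z < N x" if "z < x" for z by (rule assms(1)[OF that assms(3)])
  ultimately show ?thesis unfolding is_limit_def by blast
qed

subsection \<open>Weak reflection and trapping unbounded sets\<close>

lemma uncountable_cof_bounded_seq:
  assumes "uncountable {..<cof d}" "\<And>n::nat. s n < d"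
  shows "\<exists>b<d. \<forall>n. s n < b"
proof -
  have "\<not> cle {..<cof d} (range s)" using assms(1) countable_cle[of "range s" "{..<cof d}"] by auto
  then obtain b where "b < d" "\<forall>x\<in>range s. x < b" using bounded_of_small[of "range s" d] assms(2) by auto
  then show ?thesis by auto
qed

lemma is_limit_of_uncountable_cof:
  assumes "uncountable {..<cof d}"
  shows "is_limit d"
proof -
  have "countable X \<Longrightarrow> \<not> cle {..<cof d} X" for X :: "'a set" using assms countable_cle by blast
  then show ?thesis unfolding is_limit_def
    using bounded_of_small[of "{}" d] bounded_of_small[of "{a}" d for a] by auto
qed

text \<open>A club of \<open>d\<close> of order type \<open>cof d\<close>, given by its continuous
  increasing enumeration, so that clubs of \<open>cof d\<close> can be carried to clubs of
  \<open>d\<close>.\<close>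

definition ladder :: "('a::wellorder \<Rightarrow> 'a) \<Rightarrow> 'a \<Rightarrow> bool" where
  "ladder c d \<longleftrightarrow> (\<forall>x<cof d. c x < d) \<and> (\<forall>x<cof d. \<forall>z<x. c z < c x) \<and>
     (\<forall>x<cof d. is_limit x \<longrightarrow> (\<forall>y<c x. \<exists>z<x. y < c z)) \<and> (\<forall>y<d. \<exists>x<cof d. y < c x)"

lemma ladderD:
  assumes "ladder c d"
  shows "\<And>x. x < cof d \<Longrightarrow> c x < d" "\<And>z x. z < x \<Longrightarrow> x < cof d \<Longrightarrow> c z < c x"
    "\<And>x y. x < cof d \<Longrightarrow> is_limit x \<Longrightarrow> y < c x \<Longrightarrow> \<exists>z<x. y < c z"
    "\<And>y. y < d \<Longrightarrow> \<exists>x<cof d. y < c x"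
  using assms unfolding ladder_def by blast+

lemma ex_ladder:
  fixes d :: "'a::wellorder"
  assumes unc: "uncountable {..<cof d}"
  shows "\<exists>c. ladder c d"
proof -
  obtain X where X: "X \<subseteq> {..<d}" "unbounded_in X d" "equipotent X {..<cof d}" using cof_witness by blast
  then obtain f where f: "bij_betw f {..<cof d} X" unfolding equipotent_def using bij_betw_inv by blast
  have fd: "f z < d" if "z < cof d" for z using f X(1) that unfolding bij_betw_def by auto
  have bdd: "\<exists>b<d. \<forall>z<x. g z < b" if "x < cof d" "\<And>z. z < x \<Longrightarrow> g z < d" for x g
  proof -
    have "\<not> cle {..<cof d} (g ` {..<x})" using cof_not_cle[OF that(1)] cle_image cle_trans by blast
    then show ?thesis using bounded_of_small[of "g ` {..<x}" d] that(2) by auto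
  qed
  obtain c where c: "\<And>x. x < cof d \<Longrightarrow> c x < d" "\<And>z x. z < x \<Longrightarrow> x < cof d \<Longrightarrow> c z < c x"
    "\<And>z x. z < x \<Longrightarrow> x < cof d \<Longrightarrow> f z < c x"
    "\<And>x y. x < cof d \<Longrightarrow> is_limit x \<Longrightarrow> y < c x \<Longrightarrow> \<exists>z<x. y < c z"
    using ex_normal_seq[of "cof d" d "\<lambda>z _. f z"] bdd fd by blast
  have "\<exists>x<cof d. y < c x" if y: "y < d" for y
  proof -
    obtain z where z: "z < cof d" "y \<le> f z"
      using X(2) f y unfolding unbounded_in_def bij_betw_def by auto
    obtain x where "x < cof d" "z < x" using regular_limit[OF regular_uncountable_cof[OF unc] z(1)] by blast
    then show ?thesis using c(3)[of z x] z(2) by (auto intro: le_less_trans)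
  qed
  then show ?thesis using c(1,2,4) unfolding ladder_def by blast
qed

text \<open>A normal sequence \<open>N\<close> copies \<open>theta\<close> into \<open>lam\<close>
  so that its values at limits reached by it lie in \<open>E\<close>. Weak reflection, applied to
  \<open>tau\<close> composed with \<open>N\<close>, gives a \<open>d < theta\<close> whose image
  \<open>N d\<close> works, because clubs of \<open>N d\<close> pull back to clubs of
  \<open>d\<close>.\<close>

lemma weak_reflection_point:
  fixes lam :: "'a::wellorder"
  assumes lam: "regular_uncountable lam" and E: "club_in E lam"
    and kappa: "uncountable {..<kappa}" and theta: "theta < lam"
    and wr: "weakly_reflective theta kappa"
    and tau: "\<And>a. a < lam \<Longrightarrow> tau a < kappa"
  obtains \<alpha> where "\<alpha> \<in> E" "\<alpha> < lam" "cof \<alpha> = kappa"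
    "\<And>C. club_in C \<alpha> \<Longrightarrow> \<not> strict_mono_on C tau"
proof -
  have "\<forall>x. \<exists>c. x < lam \<longrightarrow> c \<in> E \<and> x < c \<and> c < lam"
    using club_unbounded_gt[OF lam club_unbounded[OF E]] by blast
  then obtain nx where nx: "\<And>x. x < lam \<Longrightarrow> nx x \<in> E \<and> x < nx x \<and> nx x < lam" by metis
  have bdd: "\<exists>b<lam. \<forall>z<x. g z < b" if "x < lam" "\<And>z. z < x \<Longrightarrow> g z < lam" for x g
    using regular_image_bounded[OF lam regular_uncountableD(2)[OF lam that(1)], of g] that(2) by auto
  obtain N where N: "\<And>x. x < lam \<Longrightarrow> N x < lam" "\<And>z x. z < x \<Longrightarrow> x < lam \<Longrightarrow> N z < N x"
    "\<And>z x. z < x \<Longrightarrow> x < lam \<Longrightarrow> nx (N z) < N x"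
    "\<And>x y. x < lam \<Longrightarrow> is_limit x \<Longrightarrow> y < N x \<Longrightarrow> \<exists>z<x. y < N z"
    using ex_normal_seq[of lam lam "\<lambda>_. nx"] bdd nx by blast
  have "\<exists>d\<in>S_cof theta kappa. \<forall>C. club_in C d \<longrightarrow> \<not> strict_mono_on C (\<lambda>x. tau (N x))"
  proof -
    have "\<forall>a<theta. tau (N a) < kappa" using tau N(1) theta by (meson less_trans)
    then show ?thesis using wr unfolding weakly_reflective_def strong_nonreflection_def
      by (auto dest!: spec[of _ "\<lambda>x. tau (N x)"])
  qed
  then obtain d where d: "d < theta" "cof d = kappa"
    and dC: "\<And>C. club_in C d \<Longrightarrow> \<not> strict_mono_on C (\<lambda>x. tau (N x))"
    unfolding S_cof_def by blast
  have dl: "d < lam" using d theta by simp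
  have lim: "is_limit d" using is_limit_of_uncountable_cof kappa d(2) by blast
  have Nmono: "N z < N x \<longleftrightarrow> z < x" if "z < lam" "x < lam" for z x
    using N(2) that by (metis less_asym linorder_neqE)
  have Nlim: "is_limit (N x)" if "x < lam" "is_limit x" for x
    using normal_is_limit[of lam N x] N(2,4) that by blast
  \<comment> \<open>The members \<open>nx (N z)\<close> of \<open>E\<close> interleave with the
    values of \<open>N\<close>, so \<open>N d\<close> is a limit of \<open>E\<close>.\<close>
  have NdE: "N d \<in> E"
  proof (rule club_mem_limit[OF E N(1)[OF dl] Nlim[OF dl lim]])
    fix x assume "x < N d"
    then obtain z where z: "z < d" "x < N z" using N(4)[OF dl lim] by blast
    then have "nx (N z) \<in> E" "N z < nx (N z)" "nx (N z) < N d" using nx N(1,3) dl by (meson less_trans)+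
    then show "\<exists>c\<in>E. x < c \<and> c < N d" using z by (meson less_trans)
  qed
  \<comment> \<open>Cofinal sets are pushed forward by \<open>N\<close> and pulled back by
    \<open>p\<close>, which sends \<open>y\<close> to an index where \<open>N\<close> exceeds
    \<open>y\<close>.\<close>
  have cof: "cof (N d) = cof d"
  proof (rule antisym)
    obtain X where X: "X \<subseteq> {..<d}" "unbounded_in X d" "equipotent X {..<cof d}" using cof_witness by blast
    show "cof (N d) \<le> cof d"
    proof (rule cof_le)
      show "N ` X \<subseteq> {..<N d}" using X(1) N(2) dl by auto
      show "cle (N ` X) {..<cof d}" using X(3) equipotent_cle(1) cle_image cle_trans by blast
      show "unbounded_in (N ` X) (N d)" unfolding unbounded_in_def
      proof (intro allI impI)
        fix a assume "a < N d"
        then obtain z where z: "z < d" "a < N z" using N(4)[OF dl lim] by blast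
        then obtain x where x: "x \<in> X" "z \<le> x" "x < d" using X(2) unfolding unbounded_in_def by blast
        then have "N z \<le> N x" using N(2)[of z x] dl by (cases "z = x") (auto simp: less_imp_le)
        then have "a \<le> N x" "N x < N d" using z(2) N(2)[OF x(3) dl] by auto
        then show "\<exists>c\<in>N ` X. a \<le> c \<and> c < N d" using x(1) by blast
      qed
    qed
    obtain Y where Y: "Y \<subseteq> {..<N d}" "unbounded_in Y (N d)" "equipotent Y {..<cof (N d)}" using cof_witness by blast
    have "\<forall>y\<in>Y. \<exists>z<d. y < N z" using Y(1) N(4)[OF dl lim] by auto
    then obtain p where p: "\<And>y. y \<in> Y \<Longrightarrow> p y < d \<and> y < N (p y)" by metis
    show "cof d \<le> cof (N d)"
    proof (rule cof_le)
      show "p ` Y \<subseteq> {..<d}" using p by auto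
      show "cle (p ` Y) {..<cof (N d)}" using Y(3) equipotent_cle(1) cle_image cle_trans by blast
      show "unbounded_in (p ` Y) d" unfolding unbounded_in_def
      proof (intro allI impI)
        fix a assume a: "a < d"
        then obtain y where y: "y \<in> Y" "N a \<le> y" using Y(2) N(2)[OF a dl] unfolding unbounded_in_def by blast
        then have "N a < N (p y)" using p by (meson le_less_trans)
        then have "a < p y" using Nmono a p[OF y(1)] dl by (meson less_trans)
        then show "\<exists>c\<in>p ` Y. a \<le> c \<and> c < d" using p[OF y(1)] y(1) less_imp_le by blast
      qed
    qed
  qed
  have "\<not> strict_mono_on C tau" if C: "club_in C (N d)" for C
  proof
    assume sm: "strict_mono_on C tau"
    define C' where "C' = {z. z < d \<and> N z \<in> C}"
    have "strict_mono_on C' (\<lambda>x. tau (N x))"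
    proof (rule strict_mono_onI)
      fix r s assume "r \<in> C'" "s \<in> C'" "r < s"
      then show "tau (N r) < tau (N s)" using strict_mono_onD[OF sm, of "N r" "N s"] N(2)[of r s] dl
        unfolding C'_def by auto
    qed
    moreover have "club_in C' d" unfolding club_in_def
    proof (intro conjI allI impI)
      show "C' \<subseteq> {..<d}" unfolding C'_def by auto
      show "unbounded_in C' d" unfolding unbounded_in_def
      proof (intro allI impI)
        fix a assume a: "a < d"
        \<comment> \<open>A priori \<open>C\<close> might miss all values of \<open>N\<close>.
          Interleaving \<open>C\<close> with the range of \<open>N\<close> produces a limit
          \<open>i\<close> such that \<open>N i\<close> is a limit of \<open>C\<close>; it stays
          below \<open>d\<close> because \<open>cof d\<close> is uncountable.\<close>
        have "\<exists>y<d. x < y \<and> (\<exists>c\<in>C. N x \<le> c \<and> c < N y)" if x: "x < d" for x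
        proof -
          obtain c where c: "c \<in> C" "N x \<le> c" "c < N d"
            using club_unbounded[OF C] N(2)[OF x dl] unfolding unbounded_in_def by blast
          obtain y where y: "y < d" "c < N y" using N(4)[OF dl lim c(3)] by blast
          then have "N x < N y" using c by simp
          then have "x < y" using Nmono x y(1) dl by (meson less_trans)
          then show ?thesis using c y by blast
        qed
        then obtain f where f: "\<And>x. x < d \<Longrightarrow> f x < d \<and> x < f x \<and> (\<exists>c\<in>C. N x \<le> c \<and> c < N (f x))" by metis
        obtain i where i: "a < i" "i < d" "is_limit i" "\<And>x. x < i \<Longrightarrow> \<exists>y. x \<le> y \<and> y < i \<and> f y < i"
          using omega_iteration[of d f a] uncountable_cof_bounded_seq[of d] kappa d(2) f a by metis
        have il: "i < lam" using i(2) dl by simp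
        have "N i \<in> C"
        proof (rule club_mem_limit[OF C N(2)[OF i(2) dl] Nlim[OF il i(3)]])
          fix x assume "x < N i"
          then obtain z where z: "z < i" "x < N z" using N(4)[OF il i(3)] by blast
          then obtain y where y: "z \<le> y" "y < i" "f y < i" using i(4) by blast
          then obtain c where c: "c \<in> C" "N y \<le> c" "c < N (f y)" using f i(2) by (meson less_trans)
          have "N z \<le> N y" using N(2)[of z y] y il by (cases "z = y") (auto simp: less_imp_le)
          then have "x < c" using z(2) c(2) by simp
          moreover have "c < N i" using c(3) N(2)[OF y(3) il] by simp
          ultimately show "\<exists>c\<in>C. x < c \<and> c < N i" using c(1) by blast
        qed
        then show "\<exists>c\<in>C'. a \<le> c \<and> c < d" using i unfolding C'_def by (auto intro!: exI[of _ i])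
      qed
      fix g assume g: "g < d" and *: "is_limit g \<and> (\<forall>a<g. \<exists>c\<in>C'. a < c \<and> c < g)"
      have gl: "g < lam" using g dl by simp
      have "N g \<in> C"
      proof (rule club_mem_limit[OF C N(2)[OF g dl] Nlim[OF gl conjunct1[OF *]]])
        fix x assume "x < N g"
        then obtain z where z: "z < g" "x < N z" using N(4)[OF gl conjunct1[OF *]] by blast
        then obtain c where c: "c \<in> C'" "z < c" "c < g" using * by blast
        have "c < lam" using c(3) gl by simp
        then have "x < N c" "N c < N g" using c z N(2)[of z c] N(2)[of c g] gl by (auto intro: less_trans)
        then show "\<exists>c\<in>C. x < c \<and> c < N g" using c(1) unfolding C'_def by blast
      qed
      then show "g \<in> C'" using g unfolding C'_def by blast
    qed
    ultimately show False using dC by blast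
  qed
  then show thesis using that[OF NdE N(1)[OF dl]] cof d(2) by simp
qed

text \<open>The function $\tau_A$ above. The implication inside \<open>LEAST\<close> keeps the value below
  \<open>kappa\<close> even when no index works.\<close>

definition trap_index :: "('a::wellorder \<Rightarrow> 'a \<Rightarrow> 'a set) \<Rightarrow> 'a set \<Rightarrow> 'a \<Rightarrow> 'a \<Rightarrow> 'a" where
  "trap_index a A kappa g =
    (LEAST t. t < kappa \<and> ((\<exists>t'<kappa. unbounded_in (A \<inter> a t' g) g) \<longrightarrow> unbounded_in (A \<inter> a t g) g))"

lemma trap_index:
  assumes "z < kappa"
  shows "trap_index a A kappa g < kappa"
    and "t < kappa \<Longrightarrow> unbounded_in (A \<inter> a t g) g \<Longrightarrow> unbounded_in (A \<inter> a (trap_index a A kappa g) g) g"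
proof -
  let ?P = "\<lambda>t. t < kappa \<and> ((\<exists>t'<kappa. unbounded_in (A \<inter> a t' g) g) \<longrightarrow> unbounded_in (A \<inter> a t g) g)"
  have "\<exists>t. ?P t" using assms by blast
  then have "?P (trap_index a A kappa g)" unfolding trap_index_def by (rule LeastI_ex)
  then show "trap_index a A kappa g < kappa"
    "t < kappa \<Longrightarrow> unbounded_in (A \<inter> a t g) g \<Longrightarrow> unbounded_in (A \<inter> a (trap_index a A kappa g) g) g"
    by blast+
qed

text \<open>Otherwise each \<open>A \<inter> a t (c i)\<close> is bounded below \<open>d\<close> by
  \<open>c (F1 t)\<close>, uniformly in \<open>i\<close>. For \<open>i\<close> in a suitable club
  \<open>D\<close>, \<open>tau (c i) < i\<close> is then impossible: the trapped part of
  \<open>A\<close> would be unbounded in \<open>c i\<close> and yet bounded by the smaller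
  \<open>c (F1 (tau (c i)))\<close>. So \<open>i \<le> tau (c i)\<close>, while
  \<open>tau (c x) < i\<close> for \<open>x < i\<close>, and \<open>tau\<close> increases strictly
  on the image of \<open>D\<close>.\<close>

lemma ex_trapping_index:
  fixes d :: "'a::wellorder"
  assumes unc: "uncountable {..<cof d}"
    and ladder: "ladder c d"
    and A: "unbounded_in A d"
    and a_mono: "\<And>s t g. s \<le> t \<Longrightarrow> t < cof d \<Longrightarrow> a s g \<subseteq> a t g"
    and a_cover: "\<And>b g. b < g \<Longrightarrow> g < d \<Longrightarrow> \<exists>t<cof d. b \<in> a t g"
    and no_club: "\<And>C. club_in C d \<Longrightarrow> \<not> strict_mono_on C (trap_index a A (cof d))"
  shows "\<exists>t<cof d. unbounded_in (A \<inter> (\<Union>i\<in>{..<cof d}. a t (c i))) d"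
proof (rule ccontr)
  assume neg: "\<not> ?thesis"
  let ?k = "cof d"
  note c = ladderD[OF ladder]
  define tau where "tau = trap_index a A ?k"
  have k: "regular_uncountable ?k" using regular_uncountable_cof[OF unc] .
  have tau_k: "tau g < ?k" for g
  proof -
    have "{..<?k} \<noteq> {}" using unc by (metis countable_empty)
    then obtain z where "z < ?k" by blast
    then show ?thesis unfolding tau_def by (rule trap_index)
  qed
  have c_mono: "z < x" if "c z < c x" "z < ?k" for z x
    using c(2)[of x z] that by (metis less_asym linorder_neqE)
  have "\<exists>z<?k. \<forall>i<?k. \<forall>p\<in>A \<inter> a t (c i). p < d \<longrightarrow> p < c z" if t: "t < ?k" for t
  proof -
    define X where "X = A \<inter> (\<Union>i\<in>{..<?k}. a t (c i))"
    have "\<not> unbounded_in X d" using neg t unfolding X_def by blast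
    then obtain b where b: "b < d" "\<And>p. p \<in> X \<Longrightarrow> b \<le> p \<Longrightarrow> \<not> p < d"
      unfolding unbounded_in_def by blast
    obtain z where z: "z < ?k" "b < c z" using c(4)[OF b(1)] by blast
    have "p < c z" if "i < ?k" "p \<in> A \<inter> a t (c i)" "p < d" for i p
    proof -
      have "p \<in> X" using that unfolding X_def by blast
      then have "\<not> b \<le> p" using b(2) that(3) by blast
      then show ?thesis using z(2) by simp
    qed
    then show ?thesis using z(1) by blast
  qed
  then obtain F1 where F1: "\<And>t. t < ?k \<Longrightarrow> F1 t < ?k"
    "\<And>t i p. t < ?k \<Longrightarrow> i < ?k \<Longrightarrow> p \<in> A \<inter> a t (c i) \<Longrightarrow> p < d \<Longrightarrow> p < c (F1 t)" by metis
  have "\<exists>z<?k. \<exists>p\<in>A. c i \<le> p \<and> p < c z" if i: "i < ?k" for i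
  proof -
    obtain p where p: "p \<in> A" "c i \<le> p" "p < d" using A c(1)[OF i] unfolding unbounded_in_def by blast
    then show ?thesis using c(4)[OF p(3)] by blast
  qed
  then obtain F3 where F3: "\<And>i. i < ?k \<Longrightarrow> F3 i < ?k \<and> (\<exists>p\<in>A. c i \<le> p \<and> p < c (F3 i))" by metis
  \<comment> \<open>Closure under \<open>F1\<close> keeps the bounds below \<open>c i\<close>,
    closure under \<open>tau\<close> along the ladder gives strict increase, and closure under
    \<open>F3\<close> makes \<open>c i\<close> a limit of \<open>A\<close>.\<close>
  define D where "D = closure_points (\<lambda>i. max (F1 i) (max (tau (c i)) (F3 i))) ?k"
  have D: "club_in D ?k" unfolding D_def
    by (rule club_closure_points[OF k]) (simp add: F1(1) F3 tau_k)
  have Dk: "i < ?k" and Dlim: "is_limit i"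
    and D1: "\<And>x. x < i \<Longrightarrow> F1 x < i" and D2: "\<And>x. x < i \<Longrightarrow> tau (c x) < i"
    and D3: "\<And>x. x < i \<Longrightarrow> F3 x < i" if "i \<in> D" for i
    using that unfolding D_def closure_points_def by auto
  have tau_ge: "i \<le> tau (c i)" if i: "i \<in> D" for i
  proof (rule ccontr)
    assume "\<not> i \<le> tau (c i)"
    then have lt: "tau (c i) < i" by simp
    note ik = Dk[OF i]
    have "\<exists>p\<in>A. c z \<le> p \<and> p < c i" if z: "z < i" for z
    proof -
      have "z < ?k" using z ik by simp
      then obtain p where p: "p \<in> A" "c z \<le> p" "p < c (F3 z)" using F3 by blast
      have "c (F3 z) < c i" by (rule c(2)[OF D3[OF i z] ik])
      then have "p < c i" using p(3) by simp
      then show ?thesis using p by blast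
    qed
    then obtain p where p: "\<And>z. z < i \<Longrightarrow> p z \<in> A \<and> c z \<le> p z \<and> p z < c i" by metis
    have "\<exists>t<?k. p z \<in> a t (c i)" if "z < i" for z
      using a_cover[OF conjunct2[OF conjunct2[OF p[OF that]]] c(1)[OF ik]] .
    then obtain t where t: "\<And>z. z < i \<Longrightarrow> t z < ?k \<and> p z \<in> a (t z) (c i)" by metis
    \<comment> \<open>Here \<open>i < cof d\<close> matters: the indices \<open>t z\<close> have a
      common bound, and by monotonicity a single \<open>a b (c i)\<close> holds all chosen points
      \<open>p z\<close>.\<close>
    have "\<exists>b<?k. \<forall>z\<in>{..<i}. t z < b"
      by (rule regular_image_bounded[OF k cof_not_cle[OF ik]]) (use t in blast)
    then obtain b where b: "b < ?k" "\<And>z. z < i \<Longrightarrow> t z < b" by auto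
    have "unbounded_in (A \<inter> a b (c i)) (c i)" unfolding unbounded_in_def
    proof (intro allI impI)
      fix x assume "x < c i"
      then obtain z where z: "z < i" "x < c z" using c(3)[OF ik Dlim[OF i]] by blast
      have "p z \<in> a b (c i)" using a_mono[of "t z" b "c i"] b(1) b(2)[OF z(1)] t[OF z(1)] less_imp_le by blast
      moreover have "x \<le> p z" using z(2) p[OF z(1)] by (meson le_less less_le_trans)
      ultimately show "\<exists>q\<in>A \<inter> a b (c i). x \<le> q \<and> q < c i" using p[OF z(1)] by blast
    qed
    then have unb: "unbounded_in (A \<inter> a (tau (c i)) (c i)) (c i)"
      unfolding tau_def using trap_index(2) b(1) by blast
    have "c (F1 (tau (c i))) < c i" by (rule c(2)[OF D1[OF i lt] ik])
    then obtain q where q: "q \<in> A \<inter> a (tau (c i)) (c i)" "c (F1 (tau (c i))) \<le> q" "q < c i"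
      using unb unfolding unbounded_in_def by blast
    then have "q < c (F1 (tau (c i)))" using F1(2)[OF tau_k ik q(1)] c(1)[OF ik] by (meson less_trans)
    then show False using q(2) by simp
  qed
  have "strict_mono_on (c ` D) tau"
  proof (rule strict_mono_onI)
    fix r s assume "r \<in> c ` D" "s \<in> c ` D" "r < s"
    then obtain i j where ij: "i \<in> D" "j \<in> D" "r = c i" "s = c j" "c i < c j" by blast
    then have "i < j" using c_mono Dk by blast
    then have "tau r < j" using D2 ij by blast
    then show "tau r < tau s" using tau_ge[OF ij(2)] ij(4) by simp
  qed
  moreover have "club_in (c ` D) d" unfolding club_in_def
  proof (intro conjI allI impI)
    show "c ` D \<subseteq> {..<d}" using c(1) Dk by auto
    show "unbounded_in (c ` D) d" unfolding unbounded_in_def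
    proof (intro allI impI)
      fix x assume "x < d"
      then obtain z where z: "z < ?k" "x < c z" using c(4) by blast
      then obtain i where i: "i \<in> D" "z < i" using club_unbounded_gt[OF k club_unbounded[OF D] z(1)] by blast
      then have "c z < c i" using c(2) Dk by blast
      then have "x \<le> c i" using z(2) by simp
      then show "\<exists>q\<in>c ` D. x \<le> q \<and> q < d" using i(1) c(1)[OF Dk[OF i(1)]] by blast
    qed
    fix g assume g: "g < d" and *: "is_limit g \<and> (\<forall>x<g. \<exists>q\<in>c ` D. x < q \<and> q < g)"
    \<comment> \<open>A limit \<open>g\<close> of the image of \<open>D\<close> is caught by the
      first ladder index that reaches it. This index turns out to be a limit of \<open>D\<close>,
      and continuity of the ladder excludes \<open>g < c i\<close>.\<close>
    define i where "i = (LEAST i. i < ?k \<and> g \<le> c i)"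
    have "\<exists>i. i < ?k \<and> g \<le> c i" using c(4)[OF g] less_imp_le by blast
    then have i: "i < ?k" "g \<le> c i" unfolding i_def by (metis (mono_tags, lifting) LeastI_ex)+
    have below: "c z < g" if "z < i" for z
    proof (rule ccontr)
      assume "\<not> c z < g"
      then have "i \<le> z" unfolding i_def using that i(1) by (intro Least_le) (auto simp: not_less)
      then show False using that by simp
    qed
    have nxt: "\<exists>j\<in>D. x < c j \<and> j < i \<and> c j < g" if x: "x < g" for x
    proof -
      obtain j where j: "j \<in> D" "x < c j" "c j < g" using * x by blast
      then have "c j < c i" using i(2) by simp
      then show ?thesis using j c_mono Dk by blast
    qed
    have nxt': "\<exists>j\<in>D. z < j \<and> j < i" if z: "z < i" for z
    proof -
      obtain j where "j \<in> D" "c z < c j" "j < i" using nxt[OF below[OF z]] by blast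
      then show ?thesis using c_mono z i(1) by (meson less_trans)
    qed
    have lim: "is_limit i" unfolding is_limit_def
    proof
      obtain x where "x < g" using * unfolding is_limit_def by blast
      then show "\<exists>z. z < i" using nxt by blast
      show "\<forall>z<i. \<exists>j. z < j \<and> j < i" using nxt' by blast
    qed
    have "i \<in> D" by (rule club_mem_limit[OF D i(1) lim nxt'])
    moreover have "g = c i"
    proof (rule ccontr)
      assume "g \<noteq> c i"
      then have "g < c i" using i(2) by simp
      then obtain z where "z < i" "g < c z" using c(3)[OF i(1) lim] by blast
      then show False using below[of z] by simp
    qed
    ultimately show "g \<in> c ` D" by blast
  qed
  ultimately show False using no_club unfolding tau_def by blast
qed

subsection \<open>Almost disjoint families\<close>

text \<open>Asking for both \<open>R u w\<close> and \<open>R w u\<close> avoids any symmetry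
  assumption. The notion serves for eventually different functions, antichains of stationary sets
  and disjoint collections.\<close>

definition maximal_pairwise :: "('b \<Rightarrow> 'b \<Rightarrow> bool) \<Rightarrow> 'b set \<Rightarrow> 'b set \<Rightarrow> bool" where
  "maximal_pairwise R U W \<longleftrightarrow> W \<subseteq> U \<and> pairwise R W \<and> (\<forall>u\<in>U. (\<forall>w\<in>W. R u w \<and> R w u) \<longrightarrow> u \<in> W)"

lemma maximal_pairwiseD:
  assumes "maximal_pairwise R U W"
  shows "W \<subseteq> U" "pairwise R W" "u \<in> U \<Longrightarrow> (\<And>w. w \<in> W \<Longrightarrow> R u w \<and> R w u) \<Longrightarrow> u \<in> W"
  using assms unfolding maximal_pairwise_def by blast+

lemma ex_maximal_pairwise: "\<exists>W. maximal_pairwise R U W"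
proof -
  let ?A = "{W. W \<subseteq> U \<and> pairwise R W}"
  have "\<exists>M\<in>?A. \<forall>X\<in>?A. M \<subseteq> X \<longrightarrow> X = M"
  proof (rule subset_Zorn')
    fix C assume C: "subset.chain ?A C"
    have "R x y" if xy: "x \<in> \<Union>C" "y \<in> \<Union>C" "x \<noteq> y" for x y
    proof -
      obtain X Y where XY: "X \<in> C" "Y \<in> C" "x \<in> X" "y \<in> Y" using xy by blast
      then have "X \<subseteq> Y \<or> Y \<subseteq> X" using C unfolding subset_chain_def by blast
      then obtain Z where "Z \<in> C" "x \<in> Z" "y \<in> Z" using XY by blast
      then show ?thesis using C xy(3) unfolding subset_chain_def pairwise_def by blast
    qed
    then show "\<Union>C \<in> ?A" using C unfolding subset_chain_def pairwise_def by blast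
  qed
  then obtain W where W': "W \<in> ?A" "\<forall>X\<in>?A. W \<subseteq> X \<longrightarrow> X = W" by (elim bexE)
  have W: "W \<subseteq> U" "pairwise R W" using W'(1) by simp_all
  have max: "X = W" if "X \<subseteq> U" "pairwise R X" "W \<subseteq> X" for X using W'(2) that by simp
  have "u \<in> W" if "u \<in> U" "\<forall>w\<in>W. R u w \<and> R w u" for u
  proof -
    have "pairwise R (insert u W)" using W(2) that(2) unfolding pairwise_insert by blast
    then have "insert u W = W" using W(1) that(1) by (intro max) auto
    then show ?thesis by blast
  qed
  then show ?thesis using W unfolding maximal_pairwise_def by blast
qed

definition eventually_different :: "'a::wellorder \<Rightarrow> ('a \<Rightarrow> 'a) \<Rightarrow> ('a \<Rightarrow> 'a) \<Rightarrow> bool" where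
  "eventually_different l f g \<longleftrightarrow> (\<exists>b<l. \<forall>x. b \<le> x \<and> x < l \<longrightarrow> f x \<noteq> g x)"

lemma ex_eventually_different_family:
  fixes l :: "'a::wellorder"
  assumes l: "regular_uncountable l"
  shows "\<exists>F\<subseteq>{f. \<forall>x<l. f x < l}. pairwise (eventually_different l) F \<and> \<not> cle F {..<l}"
proof -
  obtain W where mp: "maximal_pairwise (eventually_different l) {f. \<forall>x<l. f x < l} W"
    using ex_maximal_pairwise by blast
  note W = maximal_pairwiseD[OF mp]
  \<comment> \<open>A family of size at most \<open>l\<close> is diagonalised by \<open>h\<close>, hence is not maximal.\<close>
  have "\<not> cle W {..<l}"
  proof
    assume "cle W {..<l}"
    then obtain e where e: "inj_on e W" "e ` W \<subseteq> {..<l}" unfolding cle_def by blast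
    \<comment> \<open>Only the \<open>g\<close> with \<open>e g < x\<close> must be avoided at
      \<open>x\<close>, and they are too few to take all values below \<open>l\<close>.\<close>
    have "\<exists>v<l. \<forall>g\<in>W. e g < x \<longrightarrow> v \<noteq> g x" if x: "x < l" for x
    proof (rule ccontr)
      assume a: "\<not> ?thesis"
      let ?V = "{g \<in> W. e g < x}"
      have "{..<l} \<subseteq> (\<lambda>g. g x) ` ?V" using a by blast
      then have "cle {..<l} ?V" using cle_subset cle_image cle_trans by blast
      moreover have "cle ?V {..<x}" by (rule cleI[of e]) (use e(1) in \<open>auto simp: inj_on_def\<close>)
      ultimately show False using regular_uncountableD(2)[OF l x] cle_trans by blast
    qed
    then obtain h where h: "\<And>x. x < l \<Longrightarrow> h x < l \<and> (\<forall>g\<in>W. e g < x \<longrightarrow> h x \<noteq> g x)" by metis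
    have hR: "eventually_different l h g" if g: "g \<in> W" for g
    proof -
      have "e g < l" using e(2) g by blast
      then obtain b where "b < l" "e g < b" using regular_limit[OF l] by blast
      then show ?thesis unfolding eventually_different_def using h g by (meson less_le_trans)
    qed
    moreover have "eventually_different l g h" if "g \<in> W" for g
      using hR[OF that] unfolding eventually_different_def by metis
    moreover have "h \<in> {f. \<forall>x<l. f x < l}" using h by blast
    ultimately have "h \<in> W" by (intro W(3)) auto
    then show False using hR[of h] unfolding eventually_different_def by blast
  qed
  then show ?thesis using W(1,2) by blast
qed

definition almost_disjoint :: "'a::wellorder \<Rightarrow> 'a set \<Rightarrow> 'a set \<Rightarrow> bool" where
  "almost_disjoint l A B \<longleftrightarrow> (\<exists>b<l. \<forall>x\<in>A \<inter> B. x < b)"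

text \<open>The members are graphs of eventually different functions, coded as subsets of
  \<open>l\<close> by an injection \<open>p\<close> on pairs. Two of them agree only over some
  \<open>{..<b}\<close>, and an intersection of size below \<open>l\<close> is bounded by
  regularity.\<close>

lemma ex_almost_disjoint_family:
  fixes l :: "'a::wellorder"
  assumes l: "regular_uncountable l"
  shows "\<exists>\<A>. (\<forall>A\<in>\<A>. unbounded_in A l) \<and> pairwise (almost_disjoint l) \<A> \<and> \<not> cle \<A> {..<l}"
proof -
  obtain F where F: "F \<subseteq> {f. \<forall>x<l. f x < l}" "pairwise (eventually_different l) F" "\<not> cle F {..<l}"
    using ex_eventually_different_family[OF l] by blast
  have Fl: "f x < l" if "f \<in> F" "x < l" for f x using F(1) that by blast
  obtain p where p: "inj_on p ({..<l} \<times> {..<l})" "p ` ({..<l} \<times> {..<l}) \<subseteq> {..<l}"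
    using cle_Times_same[OF infinite_regular[OF l]] unfolding cle_def by blast
  define G where "G f = (\<lambda>x. p (x, f x)) ` {..<l}" for f
  have Gl: "G f \<subseteq> {..<l}" if "f \<in> F" for f using p(2) Fl[OF that] unfolding G_def by blast
  have unb: "\<not> (\<exists>b<l. \<forall>x\<in>G f. x < b)" if f: "f \<in> F" for f
  proof
    assume "\<exists>b<l. \<forall>x\<in>G f. x < b"
    then obtain b where b: "b < l" "G f \<subseteq> {..<b}" by blast
    have "inj_on (\<lambda>x. p (x, f x)) {..<l}" using p(1) Fl[OF f] unfolding inj_on_def by fastforce
    then have "cle {..<l} {..<b}" using b(2) unfolding G_def by (rule cleI)
    then show False using regular_uncountableD(2)[OF l b(1)] by blast
  qed
  have ad: "almost_disjoint l (G f) (G g)" if f: "f \<in> F" "g \<in> F" "f \<noteq> g" for f g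
  proof -
    have "eventually_different l f g" by (rule pairwiseD[OF F(2) f])
    then obtain b where b: "b < l" "\<forall>x. b \<le> x \<and> x < l \<longrightarrow> f x \<noteq> g x"
      unfolding eventually_different_def by blast
    have "G f \<inter> G g \<subseteq> (\<lambda>x. p (x, f x)) ` {..<b}"
    proof
      fix y assume y: "y \<in> G f \<inter> G g"
      obtain x where x: "x < l" "y = p (x, f x)" using y unfolding G_def by auto
      obtain z where z: "z < l" "y = p (z, g z)" using y unfolding G_def by auto
      have "(x, f x) = (z, g z)"
        by (rule inj_onD[OF p(1)]) (use x z Fl[OF f(1)] Fl[OF f(2)] in simp_all)
      then have "\<not> b \<le> x" using b(2) x(1) by blast
      then show "y \<in> (\<lambda>x. p (x, f x)) ` {..<b}" using x(2) by (intro image_eqI[of _ _ x]) auto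
    qed
    then have "cle (G f \<inter> G g) {..<b}" using cle_subset cle_image cle_trans by blast
    then have "\<not> cle {..<l} (G f \<inter> G g)" using regular_uncountableD(2)[OF l b(1)] cle_trans by blast
    then show ?thesis unfolding almost_disjoint_def
      using regular_uncountableD(3)[OF l, of "G f \<inter> G g"] Gl[OF f(1)] by blast
  qed
  \<comment> \<open>A graph code shared by two distinct functions would be almost disjoint from
    itself, hence bounded.\<close>
  have "inj_on G F"
  proof (rule inj_onI)
    fix f g assume f: "f \<in> F" "g \<in> F" "G f = G g"
    show "f = g"
    proof (rule ccontr)
      assume "f \<noteq> g"
      then show False using ad[OF f(1,2)] f(3) unb[OF f(1)] unfolding almost_disjoint_def by simp
    qed
  qed
  then have "\<not> cle (G ` F) {..<l}" using F(3) cleI[of G F "G ` F"] cle_trans by blast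
  moreover have "unbounded_in (G f) l" if f: "f \<in> F" for f
    unfolding unbounded_in_def
  proof (intro allI impI)
    fix b assume "b < l"
    then obtain x where "x \<in> G f" "\<not> x < b" using unb[OF f] by blast
    then show "\<exists>x\<in>G f. b \<le> x \<and> x < l" using Gl[OF f] by (auto simp: not_less)
  qed
  moreover have "pairwise (almost_disjoint l) (G ` F)"
    unfolding pairwise_def
  proof (intro ballI impI)
    fix A B assume AB: "A \<in> G ` F" "B \<in> G ` F" "A \<noteq> B"
    then obtain f g where "f \<in> F" "g \<in> F" "A = G f" "B = G g" by auto
    then show "almost_disjoint l A B" using ad[of f g] AB(3) by auto
  qed
  ultimately show ?thesis by (intro exI[of _ "G ` F"]) blast
qed

subsection \<open>Saturation\<close>

text \<open>The enumeration \<open>e\<close> makes the covering diagonal: at \<open>a\<close> only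
  members with \<open>e B < a\<close> count, so closure properties of \<open>a\<close> later apply
  to them. Disjointness of the families gives \<open>m\<close> different sets through one
  point.\<close>

definition covering_families ::
    "'a::wellorder \<Rightarrow> 'a \<Rightarrow> ('b \<Rightarrow> 'a set) \<Rightarrow> 'b set \<Rightarrow> ('a \<Rightarrow> 'b set) \<Rightarrow> ('b \<Rightarrow> 'a) \<Rightarrow> bool" where
  "covering_families l m S \<A> \<B> e \<longleftrightarrow> (\<forall>n<m. \<B> n \<subseteq> \<A>) \<and>
     (\<forall>n<m. \<forall>n'<m. n \<noteq> n' \<longrightarrow> \<B> n \<inter> \<B> n' = {}) \<and>
     inj_on e (\<Union>n\<in>{..<m}. \<B> n) \<and> e ` (\<Union>n\<in>{..<m}. \<B> n) \<subseteq> {..<l} \<and>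
     (\<forall>E. club_in E l \<longrightarrow> (\<exists>a\<in>E. \<forall>n<m. \<exists>B\<in>\<B> n. e B < a \<and> a \<in> S B))"

lemma covering_familiesD:
  assumes "covering_families l m S \<A> \<B> e"
  shows "\<And>n. n < m \<Longrightarrow> \<B> n \<subseteq> \<A>" "\<And>n n'. n < m \<Longrightarrow> n' < m \<Longrightarrow> n \<noteq> n' \<Longrightarrow> \<B> n \<inter> \<B> n' = {}"
    "inj_on e (\<Union>n\<in>{..<m}. \<B> n)" "e ` (\<Union>n\<in>{..<m}. \<B> n) \<subseteq> {..<l}"
    "\<And>E. club_in E l \<Longrightarrow> \<exists>a\<in>E. \<forall>n<m. \<exists>B\<in>\<B> n. e B < a \<and> a \<in> S B"
  using assms unfolding covering_families_def by simp_all

text \<open>Instead of fixing a generic filter, the argument picks a stationary set \<open>T\<close> each of whose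
  stationary subsets meets more than \<open>l\<close> many of the sets \<open>S A\<close>. Below \<open>T\<close> a maximal antichain
  refining the \<open>S A\<close> can be found outside any given small subfamily, which makes a maximal disjoint
  collection of such antichains large.\<close>

lemma saturated_covering_families:
  fixes l m :: "'a::wellorder" and S :: "'b \<Rightarrow> 'a set" and \<A> :: "'b set"
  assumes l: "regular_uncountable l" and m: "m < l"
    and big: "\<not> cle \<A> {..<l}"
    and stat: "\<And>A. A \<in> \<A> \<Longrightarrow> stationary (S A) l" and S0: "\<And>A. A \<in> \<A> \<Longrightarrow> S A \<subseteq> S0"
    and sat: "\<And>F. F \<subseteq> Pow S0 \<Longrightarrow> \<forall>X\<in>F. stationary X l \<Longrightarrow>
      pairwise (\<lambda>X Y. \<not> stationary (X \<inter> Y) l) F \<Longrightarrow> cle F {..<l}"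
  shows "\<exists>\<B> e. covering_families l m S \<A> \<B> e"
proof -
  let ?R = "\<lambda>X Y. \<not> stationary (X \<inter> Y) l"
  define meets where "meets X = {A \<in> \<A>. stationary (X \<inter> S A) l}" for X
  note inf = infinite_regular[OF l]
  have sub: "stationary X l" if "stationary Y l" "Y \<subseteq> X" "X \<subseteq> Z" "stationary Z l" for X Y Z
    using that unfolding stationary_def by blast
  \<comment> \<open>Otherwise let \<open>W\<close> be a maximal antichain of stationary sets meeting
    at most \<open>l\<close> many \<open>S A\<close> in a stationary set. Saturation bounds
    \<open>W\<close>, so some \<open>S A\<close> has stationary intersection with no member of
    \<open>W\<close>; but below this \<open>S A\<close> there is another such stationary set,
    against maximality.\<close>
  have "\<exists>T\<subseteq>S0. stationary T l \<and> (\<forall>T'\<subseteq>T. stationary T' l \<longrightarrow> \<not> cle (meets T') {..<l})"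
  proof (rule ccontr)
    assume neg: "\<not> ?thesis"
    define U where "U = {X. X \<subseteq> S0 \<and> stationary X l \<and> cle (meets X) {..<l}}"
    obtain W where mp: "maximal_pairwise ?R U W" using ex_maximal_pairwise by blast
    note W = maximal_pairwiseD(1,2)[OF mp] and max = maximal_pairwiseD(3)[OF mp]
    have "cle W {..<l}" by (rule sat) (use W in \<open>auto simp: U_def\<close>)
    then have "cle (\<Union>X\<in>W. meets X) {..<l}" by (rule cle_UN[OF inf]) (use W(1) in \<open>auto simp: U_def\<close>)
    then have "\<not> \<A> \<subseteq> (\<Union>X\<in>W. meets X)" using big cle_subset cle_trans by blast
    then obtain A where A: "A \<in> \<A>" "\<And>X. X \<in> W \<Longrightarrow> \<not> stationary (X \<inter> S A) l" unfolding meets_def by blast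
    obtain T where T: "T \<subseteq> S A" "stationary T l" "cle (meets T) {..<l}"
      using neg stat[OF A(1)] S0[OF A(1)] by blast
    then have TU: "T \<in> U" using S0[OF A(1)] unfolding U_def by blast
    have "?R T w" if w: "w \<in> W" for w
    proof
      assume "stationary (T \<inter> w) l"
      then have "stationary (w \<inter> S A) l" by (rule sub) (use T(1) stat[OF A(1)] in auto)
      then show False using A(2)[OF w] by blast
    qed
    then have "T \<in> W" using max[OF TU] by (simp add: Int_commute)
    moreover have "T \<inter> S A = T" using T(1) by blast
    ultimately show False using A(2)[of T] T(2) by simp
  qed
  then obtain T where T: "T \<subseteq> S0" "stationary T l"
    and meets_big: "\<And>T'. T' \<subseteq> T \<Longrightarrow> stationary T' l \<Longrightarrow> \<not> cle (meets T') {..<l}" by blast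
  define predense where "predense D \<longleftrightarrow> D \<subseteq> \<A> \<and> cle D {..<l} \<and>
    (\<forall>T'\<subseteq>T. stationary T' l \<longrightarrow> (\<exists>A\<in>D. stationary (T' \<inter> S A) l))" for D
  \<comment> \<open>Take a maximal antichain of stationary sets below \<open>T\<close>, each inside
    some \<open>S A\<close> with \<open>A\<close> outside \<open>E\<close>, and choose one such
    \<open>A\<close> per member. A stationary \<open>T'\<close> below \<open>T\<close> meets more
    than \<open>l\<close> many \<open>S A\<close>, hence one outside \<open>E\<close>, and so
    maximality applies.\<close>
  have ex_predense: "\<exists>D. predense D \<and> D \<inter> E = {}" if E: "cle E {..<l}" for E
  proof -
    define U where "U = {X. X \<subseteq> T \<and> stationary X l \<and> (\<exists>A\<in>\<A> - E. X \<subseteq> S A)}"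
    obtain W where mp: "maximal_pairwise ?R U W" using ex_maximal_pairwise by blast
    note W = maximal_pairwiseD(1,2)[OF mp] and max = maximal_pairwiseD(3)[OF mp]
    have cW: "cle W {..<l}" by (rule sat) (use W T(1) in \<open>auto simp: U_def\<close>)
    have "\<forall>X\<in>W. \<exists>A. A \<in> \<A> - E \<and> X \<subseteq> S A" using W(1) unfolding U_def by blast
    then obtain f where f: "\<And>X. X \<in> W \<Longrightarrow> f X \<in> \<A> - E \<and> X \<subseteq> S (f X)" by metis
    have "\<exists>A\<in>f ` W. stationary (T' \<inter> S A) l" if T': "T' \<subseteq> T" "stationary T' l" for T'
    proof (rule ccontr)
      assume neg: "\<not> ?thesis"
      have "\<not> meets T' \<subseteq> E" using meets_big[OF T'] E cle_subset cle_trans by blast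
      then obtain A where A: "A \<in> \<A> - E" "stationary (T' \<inter> S A) l" unfolding meets_def by blast
      let ?X = "T' \<inter> S A"
      have XU: "?X \<in> U" unfolding U_def using A T' by blast
      have "?R ?X w" if w: "w \<in> W" for w
      proof
        assume "stationary (?X \<inter> w) l"
        then have "stationary (T' \<inter> S (f w)) l" by (rule sub) (use T' f[OF w] in auto)
        then show False using neg w by blast
      qed
      then have XW: "?X \<in> W" using max[OF XU] by (simp add: Int_commute)
      have "stationary (T' \<inter> S (f ?X)) l" by (rule sub[OF A(2)]) (use T' f[OF XW] in auto)
      then show False using neg XW by blast
    qed
    moreover have "f ` W \<subseteq> \<A>" "f ` W \<inter> E = {}" using f by auto
    moreover have "cle (f ` W) {..<l}" using cW cle_image cle_trans by blast
    ultimately show ?thesis unfolding predense_def by blast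
  qed
  \<comment> \<open>If \<open>V\<close> had at most \<open>l\<close> members, a further predense set
    could avoid their union; it is nonempty because \<open>T\<close> itself must be met. So there
    are enough members to choose \<open>m\<close> distinct ones.\<close>
  obtain V where mp: "maximal_pairwise disjnt {D. predense D} V" using ex_maximal_pairwise by blast
  note V = maximal_pairwiseD[OF mp]
  have "\<not> cle V {..<l}"
  proof
    assume "cle V {..<l}"
    then have "cle (\<Union>D\<in>V. D) {..<l}"
      by (rule cle_UN[OF inf]) (use V(1) in \<open>auto simp: predense_def\<close>)
    then obtain D where D: "predense D" "D \<inter> (\<Union>D\<in>V. D) = {}" using ex_predense by blast
    have "disjnt D D' \<and> disjnt D' D" if "D' \<in> V" for D' using D(2) that unfolding disjnt_def by blast
    then have "D \<in> V" using D(1) by (intro V(3)) auto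
    then have "D = {}" using D(2) by blast
    then show False using D(1) T(2) unfolding predense_def by blast
  qed
  then have "cle {..<l} V" using cle_total by blast
  then obtain \<B> where \<B>: "inj_on \<B> {..<l}" "\<B> ` {..<l} \<subseteq> V" unfolding cle_def by blast
  have \<B>p: "predense (\<B> n)" if "n < m" for n
  proof -
    have "n \<in> {..<l}" using that m by simp
    then show ?thesis using \<B>(2) V(1) by blast
  qed
  have \<B>d: "\<B> n \<inter> \<B> n' = {}" if n: "n < m" "n' < m" "n \<noteq> n'" for n n'
  proof -
    have nl: "n \<in> {..<l}" "n' \<in> {..<l}" using n m by auto
    then have "\<B> n \<noteq> \<B> n'" using \<B>(1) n(3) by (simp add: inj_on_eq_iff)
    then show ?thesis using V(2) \<B>(2) nl unfolding pairwise_def disjnt_def by blast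
  qed
  have "cle {..<m} {..<l}" using m by (intro cle_subset) auto
  then have "cle (\<Union>n\<in>{..<m}. \<B> n) {..<l}"
    by (rule cle_UN[OF inf]) (use \<B>p in \<open>auto simp: predense_def\<close>)
  then obtain e where e: "inj_on e (\<Union>n\<in>{..<m}. \<B> n)" "e ` (\<Union>n\<in>{..<m}. \<B> n) \<subseteq> {..<l}"
    unfolding cle_def by blast
  have "\<exists>C. club_in C l \<and> (\<forall>a\<in>T \<inter> C. \<exists>B\<in>\<B> n. e B < a \<and> a \<in> S B)" if n: "n < m" for n
  proof -
    \<comment> \<open>The points of \<open>T\<close> where the diagonal covering fails: were they
      stationary, some \<open>B\<close> would meet them stationarily, in particular above
      \<open>e B\<close>.\<close>
    define T' where "T' = {a \<in> T. \<not> (\<exists>B\<in>\<B> n. e B < a \<and> a \<in> S B)}"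
    have "\<not> stationary T' l"
    proof
      assume "stationary T' l"
      moreover have "T' \<subseteq> T" unfolding T'_def by blast
      ultimately obtain B where B: "B \<in> \<B> n" "stationary (T' \<inter> S B) l"
        using \<B>p[OF n] unfolding predense_def by blast
      then have "e B < l" using e(2) n by blast
      then obtain a where "a \<in> T' \<inter> S B" "e B < a" using stationary_gt[OF l B(2)] by blast
      then show False using B(1) unfolding T'_def by blast
    qed
    moreover have "T' \<subseteq> {..<l}" using T(2) unfolding stationary_def T'_def by blast
    ultimately obtain C where C: "club_in C l" "T' \<inter> C = {}" unfolding stationary_def by blast
    then show ?thesis unfolding T'_def by blast
  qed
  then obtain C where C: "\<And>n. n < m \<Longrightarrow> club_in (C n) l"
    "\<And>n a. n < m \<Longrightarrow> a \<in> T \<inter> C n \<Longrightarrow> \<exists>B\<in>\<B> n. e B < a \<and> a \<in> S B" by metis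
  obtain D where D: "club_in D l" "\<And>n. n < m \<Longrightarrow> D \<subseteq> C n"
    using club_Inter[OF l regular_uncountableD(2)[OF l m], of C] C(1) by blast
  have "\<exists>a\<in>E. \<forall>n<m. \<exists>B\<in>\<B> n. e B < a \<and> a \<in> S B" if E: "club_in E l" for E
  proof -
    obtain a where a: "a \<in> T \<inter> E" "a \<in> D" using stationaryD[OF stationary_Int_club[OF l T(2) E] D(1)] by blast
    then show ?thesis using C(2) D(2) by blast
  qed
  moreover have "\<forall>n<m. \<B> n \<subseteq> \<A>" using \<B>p unfolding predense_def by blast
  moreover have "\<forall>n<m. \<forall>n'<m. n \<noteq> n' \<longrightarrow> \<B> n \<inter> \<B> n' = {}" using \<B>d by blast
  ultimately have "covering_families l m S \<A> \<B> e" unfolding covering_families_def using e by blast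
  then show ?thesis by blast
qed

section \<open>Failure of saturation\<close>

theorem theorem1p13:
  fixes mu kappa lam theta :: "'a::wellorder"
  assumes "is_cardinal mu"
    and "kappa = cof mu" and "kappa < mu"
    and "uncountable {..<kappa}"
    and "is_csucc lam mu"
    and "kappa < theta" and "theta < lam"
    and "weakly_reflective theta kappa"
  shows "\<exists>F. F \<subseteq> Pow (S_cof lam kappa) \<and> (\<forall>S\<in>F. stationary S lam) \<and>
           (\<forall>S\<in>F. \<forall>T\<in>F. S \<noteq> T \<longrightarrow> \<not> stationary (S \<inter> T) lam) \<and>
           clt {..<lam} F"
proof (rule ccontr)
  assume neg: "\<not> ?thesis"
  have sat: "cle F {..<lam}" if "F \<subseteq> Pow (S_cof lam kappa)" "\<forall>X\<in>F. stationary X lam"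
    "pairwise (\<lambda>X Y. \<not> stationary (X \<inter> Y) lam) F" for F
  proof -
    have "\<not> clt {..<lam} F" using neg that unfolding pairwise_def by blast
    then show ?thesis using cle_total unfolding clt_def by blast
  qed
  have unc_mu: "uncountable {..<mu}"
    using countable_subset[of "{..<kappa}" "{..<mu}"] assms(3,4) by fastforce
  have lam: "regular_uncountable lam" by (rule regular_uncountable_csucc[OF assms(5) unc_mu])
  have mu_lam: "mu < lam"
  proof (rule ccontr)
    assume "\<not> mu < lam"
    then have "cle {..<lam} {..<mu}" by (intro cle_subset) auto
    then show False using assms(5) unfolding is_csucc_def clt_def by blast
  qed
  have kappa_lam: "\<not> cle {..<lam} {..<kappa}" using regular_uncountableD(2)[OF lam] assms(3) mu_lam by (meson less_trans)
  have kappa: "regular_uncountable kappa" using regular_uncountable_cof assms(2,4) by blast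
  obtain z0 where z0: "z0 < kappa" using assms(4) by (metis all_not_in_conv countable_empty lessThan_iff)
  have "\<exists>m. ladder m mu" using ex_ladder assms(2,4) by blast
  then obtain m where m: "ladder m mu" by blast
  note m = ladderD[OF m, folded assms(2)]
  have "\<forall>g. \<exists>f. g < lam \<longrightarrow> inj_on f {..<g} \<and> f ` {..<g} \<subseteq> {..<mu}"
    using csucc_cle(1)[OF assms(5)] unfolding cle_def by blast
  then obtain j where j: "\<And>g. g < lam \<Longrightarrow> inj_on (j g) {..<g} \<and> j g ` {..<g} \<subseteq> {..<mu}" by metis
  \<comment> \<open>The injections \<open>j g\<close> into \<open>mu\<close> and the ladder
    \<open>m\<close> of \<open>mu\<close> split each \<open>g\<close> into an increasing union of
    \<open>kappa\<close> many pieces of size below \<open>mu\<close>.\<close>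
  define a where "a t g = {b. b < g \<and> j g b < m t}" for t g
  have a_mono: "a s g \<subseteq> a t g" if "s \<le> t" "t < kappa" for s t g
  proof -
    have "m s \<le> m t" using m(2)[of s t] that by (cases "s = t") (auto simp: less_imp_le)
    then show ?thesis unfolding a_def by auto
  qed
  have a_cover: "\<exists>t<kappa. b \<in> a t g" if b: "b < g" "g < lam" for b g
  proof -
    have "j g b < mu" using j[OF b(2)] b(1) by blast
    then show ?thesis using m(4) b(1) unfolding a_def by blast
  qed
  have "\<forall>d. \<exists>c. d \<in> S_cof lam kappa \<longrightarrow> ladder c d"
    using ex_ladder assms(4) unfolding S_cof_def by blast
  then obtain c where c: "\<And>d. d \<in> S_cof lam kappa \<Longrightarrow> ladder (c d) d" by metis
  define x where "x d t = (\<Union>i\<in>{..<kappa}. a t (c d i))" for d t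
  have x_small: "\<not> cle {..<mu} (x d t)" if d: "d \<in> S_cof lam kappa" and t: "t < kappa" for d t
  proof
    assume big: "cle {..<mu} (x d t)"
    \<comment> \<open>The maximum with \<open>kappa\<close> makes \<open>w\<close> infinite and
      bounds the number of sets in the union; \<open>w < mu\<close> rests on the singularity of
      \<open>mu\<close>.\<close>
    define w where "w = max kappa (m t)"
    have w: "w < mu" unfolding w_def using assms(3) m(1)[OF t] by simp
    have sub: "{..<kappa} \<subseteq> {..<w}" "{..<m t} \<subseteq> {..<w}" unfolding w_def by auto
    have inf: "infinite {..<w}" using infinite_regular[OF kappa] sub(1) infinite_super by blast
    have "cle (a t (c d i)) {..<w}" if "i \<in> {..<kappa}" for i
    proof -
      have "c d i < d" "d < lam" using ladderD(1)[OF c[OF d], of i] d that unfolding S_cof_def by auto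
      then have "inj_on (j (c d i)) {..<c d i}" using j by (meson less_trans)
      then have "inj_on (j (c d i)) (a t (c d i))" by (rule inj_on_subset) (auto simp: a_def)
      moreover have "j (c d i) ` a t (c d i) \<subseteq> {..<w}" using sub(2) unfolding a_def by auto
      ultimately show ?thesis by (rule cleI)
    qed
    then have "cle (x d t) {..<w}" unfolding x_def by (rule cle_UN[OF inf cle_subset[OF sub(1)]])
    then have "cle {..<mu} {..<w}" using big cle_trans by blast
    moreover have "cle {..<w} {..<mu}" using w by (intro cle_subset) auto
    ultimately have "equipotent {..<w} {..<mu}" by (intro cle_antisym)
    then show False using assms(1) w unfolding is_cardinal_def by blast
  qed
  define S where "S t A = {d \<in> S_cof lam kappa. unbounded_in (A \<inter> x d t) d}" for t A
  have S_sub: "S t A \<subseteq> {..<lam}" for t A unfolding S_def S_cof_def by auto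
  have stat: "\<exists>t\<in>{..<kappa}. stationary (S t A) lam" if A: "unbounded_in A lam" for A
  proof (rule stationary_UN_small[OF lam kappa_lam])
    have ex: "\<exists>d. d \<in> (\<Union>t\<in>{..<kappa}. S t A) \<inter> E" if E: "club_in E lam" for E
    proof -
      have fin: "\<not> cle {..<lam} (UNIV :: bool set)"
        using regular_uncountableD(1)[OF lam] countable_cle by (metis finite_class.finite_UNIV countable_finite)
      have unb: "unbounded_in (if i then E else A) lam" for i using A club_unbounded[OF E] by simp
      \<comment> \<open>The index type \<open>bool\<close> handles \<open>E\<close> and
        \<open>A\<close> together: every point of \<open>C\<close> is a limit of both, so the one
        given by weak reflection lies in \<open>E\<close> and has \<open>A\<close> unbounded in
        it.\<close>
      obtain C where C: "club_in C lam"
        "\<And>d. d \<in> C \<Longrightarrow> is_limit d \<and> (\<forall>i\<in>UNIV. \<forall>y<d. \<exists>p\<in>if i then E else A. y < p \<and> p < d)"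
        using club_Inter_small[OF lam fin, of "\<lambda>i. if i then E else A"] unb by blast
      obtain d where d: "d \<in> C" "d < lam" "cof d = kappa"
        and dC: "\<And>C. club_in C d \<Longrightarrow> \<not> strict_mono_on C (trap_index a A kappa)"
        using weak_reflection_point[OF lam C(1) assms(4,7,8), of "trap_index a A kappa"]
          trap_index(1)[OF z0] by blast
      have lims: "\<And>y. y < d \<Longrightarrow> \<exists>p\<in>E. y < p \<and> p < d" "\<And>y. y < d \<Longrightarrow> \<exists>p\<in>A. y < p \<and> p < d"
        using C(2)[OF d(1)] by (metis UNIV_I)+
      have dE: "d \<in> E" by (rule club_mem_limit[OF E d(2)]) (use C(2)[OF d(1)] lims(1) in blast)+
      have Ad: "unbounded_in A d" unfolding unbounded_in_def using lims(2) less_imp_le by blast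
      have dS: "d \<in> S_cof lam kappa" using d unfolding S_cof_def by blast
      have "\<exists>t<cof d. unbounded_in (A \<inter> (\<Union>i\<in>{..<cof d}. a t (c d i))) d"
      proof (rule ex_trapping_index[OF _ c[OF dS] Ad])
        show "uncountable {..<cof d}" using d(3) assms(4) by simp
        show "a s g \<subseteq> a t g" if "s \<le> t" "t < cof d" for s t g using a_mono d(3) that by simp
        show "\<exists>t<cof d. b \<in> a t g" if "b < g" "g < d" for b g
          using a_cover[OF that(1)] d(2,3) that(2) by (auto intro: less_trans)
        show "\<not> strict_mono_on C (trap_index a A (cof d))" if "club_in C d" for C
          using dC[OF that] d(3) by simp
      qed
      then show ?thesis using dE dS d(3) unfolding S_def x_def by auto
    qed
    show "stationary (\<Union>t\<in>{..<kappa}. S t A) lam" unfolding stationary_def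
    proof (intro conjI allI impI)
      show "(\<Union>t\<in>{..<kappa}. S t A) \<subseteq> {..<lam}" by (rule UN_least) (rule S_sub)
      show "(\<Union>t\<in>{..<kappa}. S t A) \<inter> E \<noteq> {}" if "club_in E lam" for E
        by (rule ex_in_conv[THEN iffD1, OF ex[OF that]])
    qed
  qed
  obtain \<A> where \<A>: "\<And>A. A \<in> \<A> \<Longrightarrow> unbounded_in A lam" "pairwise (almost_disjoint lam) \<A>"
    "\<not> cle \<A> {..<lam}" using ex_almost_disjoint_family[OF lam] by blast
  \<comment> \<open>Pigeonhole: \<open>kappa\<close> many indices cannot cover a family of more than
    \<open>lam\<close> sets by pieces of size at most \<open>lam\<close>.\<close>
  have "\<exists>t<kappa. \<not> cle {A \<in> \<A>. stationary (S t A) lam} {..<lam}"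
  proof (rule ccontr)
    assume small: "\<not> ?thesis"
    have "cle {..<kappa} {..<lam}" using assms(3) mu_lam by (intro cle_subset) auto
    then have "cle (\<Union>t\<in>{..<kappa}. {A \<in> \<A>. stationary (S t A) lam}) {..<lam}"
      by (rule cle_UN[OF infinite_regular[OF lam]]) (use small in blast)
    moreover have "\<A> \<subseteq> (\<Union>t\<in>{..<kappa}. {A \<in> \<A>. stationary (S t A) lam})" using stat \<A>(1) by blast
    ultimately show False using \<A>(3) cle_subset cle_trans by blast
  qed
  then obtain t where t: "t < kappa" "\<not> cle {A \<in> \<A>. stationary (S t A) lam} {..<lam}" by blast
  have "\<exists>\<B> e. covering_families lam mu (S t) {A \<in> \<A>. stationary (S t A) lam} \<B> e"
  proof (rule saturated_covering_families[OF lam mu_lam t(2) _ _ sat])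
    show "stationary (S t A) lam" if "A \<in> {A \<in> \<A>. stationary (S t A) lam}" for A using that by blast
    show "S t A \<subseteq> S_cof lam kappa" for A unfolding S_def by blast
  qed
  then obtain \<B> e where "covering_families lam mu (S t) {A \<in> \<A>. stationary (S t A) lam} \<B> e" by blast
  note cover = covering_familiesD[OF this]
  note \<B> = cover(1) and \<B>_disj = cover(2) and e = cover(3,4) and hit = cover(5)
  define U where "U = (\<Union>n\<in>{..<mu}. \<B> n)"
  note e = e[folded U_def]
  have U\<A>: "U \<subseteq> \<A>" using \<B> unfolding U_def by blast
  \<comment> \<open>Fewer than \<open>lam\<close> many members precede \<open>B\<close> in the
    enumeration \<open>e\<close>, so the bounds of their intersections with \<open>B\<close> have a
    common bound.\<close>
  have "\<exists>g<lam. \<forall>B'\<in>U. e B' < e B \<longrightarrow> (\<forall>y\<in>B \<inter> B'. y < g)" if B: "B \<in> U" for B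
  proof -
    let ?I = "{B' \<in> U. e B' < e B}"
    have "e B < lam" using e(2) B by blast
    moreover have "cle ?I {..<e B}" by (rule cleI[of e]) (use e(1) in \<open>auto simp: inj_on_def\<close>)
    ultimately have I: "\<not> cle {..<lam} ?I" using regular_uncountableD(2)[OF lam] cle_trans by blast
    have "\<exists>b<lam. \<forall>y\<in>B \<inter> B'. y < b" if B': "B' \<in> ?I" for B'
    proof -
      have "B \<in> \<A>" "B' \<in> \<A>" "B \<noteq> B'" using B B' U\<A> by auto
      then show ?thesis using pairwiseD[OF \<A>(2)] unfolding almost_disjoint_def by blast
    qed
    then obtain b where b: "\<And>B'. B' \<in> ?I \<Longrightarrow> b B' < lam \<and> (\<forall>y\<in>B \<inter> B'. y < b B')" by metis
    then obtain g where "g < lam" "\<forall>B'\<in>?I. b B' < g" using regular_image_bounded[OF lam I, of b] by blast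
    then show ?thesis using b by (metis (mono_tags, lifting) less_trans mem_Collect_eq)
  qed
  then obtain G where G: "\<And>B. B \<in> U \<Longrightarrow> G B < lam"
    "\<And>B B' y. B \<in> U \<Longrightarrow> B' \<in> U \<Longrightarrow> e B' < e B \<Longrightarrow> y \<in> B \<Longrightarrow> y \<in> B' \<Longrightarrow> y < G B" by (metis IntI)
  \<comment> \<open>\<open>G\<close> is transferred to ordinals along \<open>e\<close>, with the
    identity as default off its range, so that a closure point \<open>d\<close> above
    \<open>e B\<close> is also above \<open>G B\<close>.\<close>
  define f where "f y = (if y \<in> e ` U then G (inv_into U e y) else y)" for y
  have fe: "f (e B) = G B" if "B \<in> U" for B unfolding f_def using that e(1) by simp
  have "f y < lam" if "y < lam" for y
    unfolding f_def using that by (simp add: G(1) inv_into_into)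
  then have "club_in (closure_points f lam) lam" by (rule club_closure_points[OF lam])
  from hit[OF this] obtain d where d: "d \<in> closure_points f lam"
    and "\<forall>n<mu. \<exists>B\<in>\<B> n. e B < d \<and> d \<in> S t B" by blast
  then obtain B where B: "\<And>n. n < mu \<Longrightarrow> B n \<in> \<B> n \<and> e (B n) < d \<and> d \<in> S t (B n)" by metis
  have BU: "B n \<in> U" if "n < mu" for n using B[OF that] that unfolding U_def by blast
  have GBd: "G (B n) < d" if "n < mu" for n
  proof -
    have "f (e (B n)) < d" using d B[OF that] unfolding closure_points_def by blast
    then show ?thesis using fe[OF BU[OF that]] by simp
  qed
  \<comment> \<open>The trace of \<open>B n\<close> on \<open>x d t\<close> is unbounded in
    \<open>d\<close>, so it has a point past \<open>G (B n)\<close>. From there on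
    \<open>B n\<close> shares no point with members enumerated earlier, which makes the points
    \<open>y n\<close> distinct.\<close>
  have "\<exists>y. y \<in> B n \<inter> x d t \<and> G (B n) \<le> y" if n: "n < mu" for n
  proof -
    have "unbounded_in (B n \<inter> x d t) d" using B[OF n] unfolding S_def by blast
    then show ?thesis using GBd[OF n] unfolding unbounded_in_def by blast
  qed
  then obtain y where y: "\<And>n. n < mu \<Longrightarrow> y n \<in> B n \<inter> x d t \<and> G (B n) \<le> y n" by metis
  have ne: "\<not> e (B n') < e (B n)" if n: "n < mu" "n' < mu" "y n = y n'" for n n'
  proof
    assume "e (B n') < e (B n)"
    then have "y n < G (B n)" by (rule G(2)[OF BU[OF n(1)] BU[OF n(2)]]) (use y n in force)+
    then show False using y[OF n(1)] leD by blast
  qed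
  have "inj_on y {..<mu}"
  proof (rule inj_onI)
    fix n n' assume "n \<in> {..<mu}" "n' \<in> {..<mu}" and eq: "y n = y n'"
    then have n: "n < mu" "n' < mu" by auto
    have "e (B n) = e (B n')" using ne[OF n eq] ne[OF n(2,1) eq[symmetric]] by simp
    then have "B n = B n'" using inj_onD[OF e(1)] BU n by blast
    then show "n = n'" using B[OF n(1)] B[OF n(2)] \<B>_disj[OF n] by auto
  qed
  then have "cle {..<mu} (x d t)" by (rule cleI) (use y in auto)
  moreover have "d \<in> S_cof lam kappa"
  proof -
    \<comment> \<open>The cofinality of \<open>d\<close> is known only through the sets
      \<open>S t (B n)\<close> containing it, so some index below \<open>mu\<close> has to be
      exhibited.\<close>
    have "z0 < mu" using z0 assms(3) by simp
    then show ?thesis using B unfolding S_def by blast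
  qed
  ultimately show False using x_small[OF _ t(1)] by blast
qed

end
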